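(* Let $(\mathbb{C},p:\dot{\mathcal{U}}\to\mathcal{U})$ and $(\mathbb{D},q:\dot{\mathcal{V}}\to\mathcal{V})$ be natural models. Specifying a morphism of natural models $(\mathbb{C},p)\to(\mathbb{D},q)$ is equivalent to specifying a functor $F_0:\mathbb{C}\to\mathbb{D}$ preserving distinguished terminal objects together with functors $F_1:\int_{\mathbb{C}}\mathcal{U}\to\int_{\mathbb{D}}\mathcal{V}$ and $F_2:\int_{\mathbb{C}}\dot{\mathcal{U}}\to\int_{\mathbb{D}}\dot{\mathcal{V}}$ such that: (1) $\pi\circ F_1=F_0\circ\pi$, $\pi\circ F_2=F_0\circ\pi$ and $(\int q)\circ F_2=F_1\circ(\int p)$; (2) $F_1,F_2$ respect the adjunctions $\int p\dashv p^*$ and $\int q\dashv q^*$, in the sense that $F_2\circ p^*=q^*\circ F_1$ and, writing $(\eta,\varepsilon)$ and $(\sigma,\tau)$ for the respective (unit, counit) pairs, $F_1\varepsilon=\tau F_1$ and $F_2\eta=\sigma F_2$. (The functors correspond to a morphism $F$ via $F_0=F$ on the base category, $F_1(\Gamma,A)=(F\Gamma,FA)$, $F_2(\Gamma,a)=(F\Gamma,Fa)$.)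
   Context: Write $\mathsf{y}$ for the Yoneda embedding; elements $x\in P(\Gamma)$ of a presheaf are identified with maps $\mathsf{y}(\Gamma)\to P$, and $x[\sigma]=P(\sigma)(x)$. A natural model $(\mathbb{C},p)$ consists of a small category $\mathbb{C}$ with a distinguished terminal object $\diamond$, presheaves $\mathcal{U},\dot{\mathcal{U}}$ on $\mathbb{C}$, a natural transformation $p:\dot{\mathcal{U}}\to\mathcal{U}$ and, for each object $\Gamma$ and $A\in\mathcal{U}(\Gamma)$, a chosen object $\Gamma\cdot A$, morphism $\mathsf{p}_A:\Gamma\cdot A\to\Gamma$ and element $\mathsf{q}_A\in\dot{\mathcal{U}}(\Gamma\cdot A)$ such that the square with top $\mathsf{q}_A$, right $p$, left $\mathsf{y}(\mathsf{p}_A)$, bottom $A$ is a pullback. For $(\mathbb{D},q)$ the chosen data are written $\star$, $\Gamma\circ A$, $\mathsf{u}_A$, $\mathsf{v}_A$. Natural models are models of an essentially algebraic theory, and a morphism of natural models is a homomorphism of such models; explicitly, it consists of a functor $F:\mathbb{C}\to\mathbb{D}$ (strictly) preserving distinguished terminal objects and functions $\mathcal{U}(\Gamma)\to\mathcal{V}(F\Gamma)$, $A\mapsto FA$, and $\dot{\mathcal{U}}(\Gamma)\to\dot{\mathcal{V}}(F\Gamma)$, $a\mapsto Fa$, for each $\Gamma$, such that $F(A[\sigma])=FA[F\sigma]$, $F(a[\sigma])=Fa[F\sigma]$, $q_{F\Gamma}(Fa)=F(p_\Gamma(a))$, and $F(\Gamma\cdot A)=F\Gamma\circ FA$, $F(\mathsf{p}_A)=\mathsf{u}_{FA}$,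 $F(\mathsf{q}_A)=\mathsf{v}_{FA}$ (strict equalities). For a presheaf $P$ on $\mathbb{C}$, $\int_{\mathbb{C}}P$ is its category of elements: objects $(\Gamma,x)$ with $x\in P(\Gamma)$, morphisms $(\Delta,y)\to(\Gamma,x)$ the $\sigma:\Delta\to\Gamma$ with $x[\sigma]=y$; $\pi$ denotes the projection to the base category. $\int p:\int\dot{\mathcal{U}}\to\int\mathcal{U}$ is $(\Gamma,a)\mapsto(\Gamma,p_\Gamma(a))$. Its right adjoint $p^*:\int\mathcal{U}\to\int\dot{\mathcal{U}}$ determined by the representability data is $(\Gamma,A)\mapsto(\Gamma\cdot A,\mathsf{q}_A)$; the counit at $(\Gamma,A)$ is $\mathsf{p}_A$, and the unit at $(\Gamma,a)$, with $A=p_\Gamma(a)$, is the unique $\Gamma\to\Gamma\cdot A$ whose composite with $\mathsf{p}_A$ is $\mathrm{id}_\Gamma$ and along which $\mathsf{q}_A$ restricts to $a$. Likewise for $q$. *)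

theory Defs
  imports Main "HOL-Library.FuncSet"
begin

section \<open>Categories and functors\<close>

record ('o, 'a) cat =
  Obj :: "'o set"
  Arr :: "'a set"
  Dom :: "'a \<Rightarrow> 'o"
  Cod :: "'a \<Rightarrow> 'o"
  Ident :: "'o \<Rightarrow> 'a"
  Comp :: "'a \<Rightarrow> 'a \<Rightarrow> 'a"  \<comment> \<open>\<open>Comp C g f\<close> is \<open>g\<close> after \<open>f\<close>\<close>

definition hom :: "('o, 'a) cat \<Rightarrow> 'o \<Rightarrow> 'o \<Rightarrow> 'a set" where
  "hom C X Y = {f \<in> Arr C. Dom C f = X \<and> Cod C f = Y}"

locale category =
  fixes C :: "('o, 'a) cat"
  assumes Dom_in: "f \<in> Arr C \<Longrightarrow> Dom C f \<in> Obj C"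
    and Cod_in: "f \<in> Arr C \<Longrightarrow> Cod C f \<in> Obj C"
    and Ident_in: "X \<in> Obj C \<Longrightarrow> Ident C X \<in> hom C X X"
    and Comp_in: "f \<in> hom C X Y \<Longrightarrow> g \<in> hom C Y Z \<Longrightarrow> Comp C g f \<in> hom C X Z"
    and Comp_Ident: "f \<in> hom C X Y \<Longrightarrow> Comp C f (Ident C X) = f"
    and Ident_Comp: "f \<in> hom C X Y \<Longrightarrow> Comp C (Ident C Y) f = f"
    and Comp_assoc: "f \<in> hom C W X \<Longrightarrow> g \<in> hom C X Y \<Longrightarrow> h \<in> hom C Y Z \<Longrightarrow>
      Comp C h (Comp C g f) = Comp C (Comp C h g) f"

definition is_terminal :: "('o, 'a) cat \<Rightarrow> 'o \<Rightarrow> bool" where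
  "is_terminal C T \<longleftrightarrow> T \<in> Obj C \<and> (\<forall>X \<in> Obj C. \<exists>!f. f \<in> hom C X T)"

record ('o, 'a, 'p, 'b) func =
  omap :: "'o \<Rightarrow> 'p"
  amap :: "'a \<Rightarrow> 'b"

text \<open>The maps of a functor are \<^const>\<open>undefined\<close> outside the carriers of its source (this is
  \<open>\<rightarrow>\<^sub>E\<close>), so that equality of functors is equality in the logic. For the same reason composition
  of functors and whiskering take the source category as an argument.\<close>

definition is_functor ::
  "('o, 'a) cat \<Rightarrow> ('p, 'b) cat \<Rightarrow> ('o, 'a, 'p, 'b) func \<Rightarrow> bool" where
  "is_functor C D F \<longleftrightarrow>
     omap F \<in> Obj C \<rightarrow>\<^sub>E Obj D \<and>
     amap F \<in> Arr C \<rightarrow>\<^sub>E Arr D \<and>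
     (\<forall>f \<in> Arr C. Dom D (amap F f) = omap F (Dom C f) \<and> Cod D (amap F f) = omap F (Cod C f)) \<and>
     (\<forall>X \<in> Obj C. amap F (Ident C X) = Ident D (omap F X)) \<and>
     (\<forall>X Y Z. \<forall>f \<in> hom C X Y. \<forall>g \<in> hom C Y Z.
        amap F (Comp C g f) = Comp D (amap F g) (amap F f))"

definition func_id :: "('o, 'a) cat \<Rightarrow> ('o, 'a, 'o, 'a) func" where
  "func_id C = \<lparr> omap = (\<lambda>X \<in> Obj C. X), amap = (\<lambda>f \<in> Arr C. f) \<rparr>"

definition func_comp ::
  "('o, 'a) cat \<Rightarrow> ('p, 'b, 'q, 'c) func \<Rightarrow> ('o, 'a, 'p, 'b) func \<Rightarrow> ('o, 'a, 'q, 'c) func" where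
  "func_comp C G F =
     \<lparr> omap = (\<lambda>X \<in> Obj C. omap G (omap F X)), amap = (\<lambda>f \<in> Arr C. amap G (amap F f)) \<rparr>"

definition is_nat_trans ::
  "('o, 'a) cat \<Rightarrow> ('p, 'b) cat \<Rightarrow> ('o, 'a, 'p, 'b) func \<Rightarrow> ('o, 'a, 'p, 'b) func \<Rightarrow>
   ('o \<Rightarrow> 'b) \<Rightarrow> bool" where
  "is_nat_trans C D F G \<theta> \<longleftrightarrow>
     \<theta> \<in> (\<Pi>\<^sub>E X \<in> Obj C. hom D (omap F X) (omap G X)) \<and>
     (\<forall>f \<in> Arr C. Comp D (\<theta> (Cod C f)) (amap F f) = Comp D (amap G f) (\<theta> (Dom C f)))"

definition whisker_left ::
  "('o, 'a) cat \<Rightarrow> ('p, 'b, 'q, 'c) func \<Rightarrow> ('o \<Rightarrow> 'b) \<Rightarrow> 'o \<Rightarrow> 'c" where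
  "whisker_left C H \<theta> = (\<lambda>X \<in> Obj C. amap H (\<theta> X))"

definition whisker_right ::
  "('o, 'a) cat \<Rightarrow> ('p \<Rightarrow> 'c) \<Rightarrow> ('o, 'a, 'p, 'b) func \<Rightarrow> 'o \<Rightarrow> 'c" where
  "whisker_right C \<theta> H = (\<lambda>X \<in> Obj C. \<theta> (omap H X))"

definition is_adjunction ::
  "('o, 'a) cat \<Rightarrow> ('p, 'b) cat \<Rightarrow> ('o, 'a, 'p, 'b) func \<Rightarrow> ('p, 'b, 'o, 'a) func \<Rightarrow>
   ('o \<Rightarrow> 'a) \<Rightarrow> ('p \<Rightarrow> 'b) \<Rightarrow> bool" where
  "is_adjunction C D L R \<eta> \<epsilon> \<longleftrightarrow>
     is_functor C D L \<and> is_functor D C R \<and>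
     is_nat_trans C C (func_id C) (func_comp C R L) \<eta> \<and>
     is_nat_trans D D (func_comp D L R) (func_id D) \<epsilon> \<and>
     (\<forall>X \<in> Obj C. Comp D (\<epsilon> (omap L X)) (amap L (\<eta> X)) = Ident D (omap L X)) \<and>
     (\<forall>Y \<in> Obj D. Comp C (amap R (\<epsilon> Y)) (\<eta> (omap R Y)) = Ident C (omap R Y))"


section \<open>Presheaves\<close>

text \<open>\<open>Res P \<sigma> x\<close> is \<open>x[\<sigma>]\<close>.\<close>

record ('o, 'a, 'x) psh =
  Fib :: "'o \<Rightarrow> 'x set"
  Res :: "'a \<Rightarrow> 'x \<Rightarrow> 'x"

definition is_presheaf :: "('o, 'a) cat \<Rightarrow> ('o, 'a, 'x) psh \<Rightarrow> bool" where
  "is_presheaf C P \<longleftrightarrow>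
     (\<forall>\<sigma> \<in> Arr C. Res P \<sigma> \<in> Fib P (Cod C \<sigma>) \<rightarrow> Fib P (Dom C \<sigma>)) \<and>
     (\<forall>\<Gamma> \<in> Obj C. \<forall>x \<in> Fib P \<Gamma>. Res P (Ident C \<Gamma>) x = x) \<and>
     (\<forall>\<Theta> \<Delta> \<Gamma>. \<forall>\<tau> \<in> hom C \<Theta> \<Delta>. \<forall>\<sigma> \<in> hom C \<Delta> \<Gamma>. \<forall>x \<in> Fib P \<Gamma>.
        Res P (Comp C \<sigma> \<tau>) x = Res P \<tau> (Res P \<sigma> x))"

definition is_psh_map ::
  "('o, 'a) cat \<Rightarrow> ('o, 'a, 'x) psh \<Rightarrow> ('o, 'a, 'y) psh \<Rightarrow> ('o \<Rightarrow> 'x \<Rightarrow> 'y) \<Rightarrow> bool" where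
  "is_psh_map C P Q \<alpha> \<longleftrightarrow>
     (\<forall>\<Gamma> \<in> Obj C. \<alpha> \<Gamma> \<in> Fib P \<Gamma> \<rightarrow> Fib Q \<Gamma>) \<and>
     (\<forall>\<sigma> \<in> Arr C. \<forall>x \<in> Fib P (Cod C \<sigma>).
        \<alpha> (Dom C \<sigma>) (Res P \<sigma> x) = Res Q \<sigma> (\<alpha> (Cod C \<sigma>) x))"

definition yoneda :: "('o, 'a) cat \<Rightarrow> 'o \<Rightarrow> ('o, 'a, 'a) psh" where
  "yoneda C \<Gamma> = \<lparr> Fib = (\<lambda>\<Delta>. hom C \<Delta> \<Gamma>), Res = (\<lambda>\<sigma> f. Comp C f \<sigma>) \<rparr>"

definition yoneda_map :: "('o, 'a) cat \<Rightarrow> 'a \<Rightarrow> 'o \<Rightarrow> 'a \<Rightarrow> 'a" where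
  "yoneda_map C f = (\<lambda>\<Delta> g. Comp C f g)"

text \<open>The map \<open>y(\<Gamma>) \<rightarrow> P\<close> identified with an element \<open>x\<close> of \<open>P(\<Gamma>)\<close>.\<close>

definition element_map :: "('o, 'a, 'x) psh \<Rightarrow> 'x \<Rightarrow> 'o \<Rightarrow> 'a \<Rightarrow> 'x" where
  "element_map P x = (\<lambda>\<Delta> \<sigma>. Res P \<sigma> x)"

text \<open>Pullback squares of presheaves (\<open>t : W \<rightarrow> X\<close> top, \<open>l : W \<rightarrow> Y\<close> left, \<open>r : X \<rightarrow> Z\<close> right,
  \<open>b : Y \<rightarrow> Z\<close> bottom), described pointwise because a definition cannot quantify over test presheaves
  with values in arbitrary types. Lemmas \<open>psh_pullback_universal\<close> and \<open>psh_pullback_if_universal\<close>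
  relate this to the universal property.\<close>

definition is_psh_pullback ::
  "('o, 'a) cat \<Rightarrow> ('o, 'a, 'w) psh \<Rightarrow> ('o, 'a, 'x) psh \<Rightarrow> ('o, 'a, 'y) psh \<Rightarrow> ('o, 'a, 'z) psh \<Rightarrow>
   ('o \<Rightarrow> 'w \<Rightarrow> 'x) \<Rightarrow> ('o \<Rightarrow> 'w \<Rightarrow> 'y) \<Rightarrow> ('o \<Rightarrow> 'x \<Rightarrow> 'z) \<Rightarrow> ('o \<Rightarrow> 'y \<Rightarrow> 'z) \<Rightarrow> bool" where
  "is_psh_pullback C W X Y Z t l r b \<longleftrightarrow>
     is_psh_map C W X t \<and> is_psh_map C W Y l \<and> is_psh_map C X Z r \<and> is_psh_map C Y Z b \<and>
     (\<forall>\<Gamma> \<in> Obj C.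
        (\<forall>w \<in> Fib W \<Gamma>. r \<Gamma> (t \<Gamma> w) = b \<Gamma> (l \<Gamma> w)) \<and>
        (\<forall>x \<in> Fib X \<Gamma>. \<forall>y \<in> Fib Y \<Gamma>. r \<Gamma> x = b \<Gamma> y \<longrightarrow>
           (\<exists>!w. w \<in> Fib W \<Gamma> \<and> t \<Gamma> w = x \<and> l \<Gamma> w = y)))"

lemma yoneda_presheaf:
  assumes "category C"
  shows "is_presheaf C (yoneda C \<Gamma>)"
proof -
  interpret category C by fact
  show ?thesis
    unfolding is_presheaf_def yoneda_def
    by (auto intro: Comp_in Comp_Ident Comp_assoc simp: hom_def)
      (use Comp_in Comp_Ident Comp_assoc in \<open>force simp: hom_def\<close>)+
qed

lemma presheaf_Ident:
  "is_presheaf C P \<Longrightarrow> \<Gamma> \<in> Obj C \<Longrightarrow> x \<in> Fib P \<Gamma> \<Longrightarrow> Res P (Ident C \<Gamma>) x = x"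
  by (simp add: is_presheaf_def)

lemma presheaf_Res_in:
  "is_presheaf C P \<Longrightarrow> \<sigma> \<in> hom C \<Delta> \<Gamma> \<Longrightarrow> x \<in> Fib P \<Gamma> \<Longrightarrow> Res P \<sigma> x \<in> Fib P \<Delta>"
  by (auto simp: is_presheaf_def hom_def)

lemma presheaf_Comp:
  "is_presheaf C P \<Longrightarrow> \<tau> \<in> hom C \<Theta> \<Delta> \<Longrightarrow> \<sigma> \<in> hom C \<Delta> \<Gamma> \<Longrightarrow> x \<in> Fib P \<Gamma> \<Longrightarrow>
   Res P (Comp C \<sigma> \<tau>) x = Res P \<tau> (Res P \<sigma> x)"
  by (simp add: is_presheaf_def)

lemma psh_map_in:
  "is_psh_map C P Q \<alpha> \<Longrightarrow> \<Gamma> \<in> Obj C \<Longrightarrow> x \<in> Fib P \<Gamma> \<Longrightarrow> \<alpha> \<Gamma> x \<in> Fib Q \<Gamma>"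
  by (auto simp: is_psh_map_def)

lemma psh_map_Res:
  "is_psh_map C P Q \<alpha> \<Longrightarrow> \<sigma> \<in> Fib (yoneda C \<Gamma>) \<Delta> \<Longrightarrow> x \<in> Fib P \<Gamma> \<Longrightarrow>
   \<alpha> \<Delta> (Res P \<sigma> x) = Res Q \<sigma> (\<alpha> \<Gamma> x)"
  by (auto simp: is_psh_map_def yoneda_def hom_def)

lemma element_map_psh_map:
  "is_presheaf C P \<Longrightarrow> \<Gamma> \<in> Obj C \<Longrightarrow> x \<in> Fib P \<Gamma> \<Longrightarrow>
   is_psh_map C (yoneda C \<Gamma>) P (element_map P x)"
  unfolding is_psh_map_def is_presheaf_def yoneda_def element_map_def by (auto simp: hom_def)

lemma psh_pullback_universal:
  assumes C: "category C" and W: "is_presheaf C W" and T: "is_presheaf C T"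
    and pb: "is_psh_pullback C W X Y Z t l r b"
    and f: "is_psh_map C T X f" and g: "is_psh_map C T Y g"
    and comm: "\<And>\<Gamma> s. \<Gamma> \<in> Obj C \<Longrightarrow> s \<in> Fib T \<Gamma> \<Longrightarrow> r \<Gamma> (f \<Gamma> s) = b \<Gamma> (g \<Gamma> s)"
  shows "\<exists>h. (is_psh_map C T W h \<and>
              (\<forall>\<Gamma> \<in> Obj C. \<forall>s \<in> Fib T \<Gamma>. t \<Gamma> (h \<Gamma> s) = f \<Gamma> s \<and> l \<Gamma> (h \<Gamma> s) = g \<Gamma> s)) \<and>
             (\<forall>k. is_psh_map C T W k \<and>
              (\<forall>\<Gamma> \<in> Obj C. \<forall>s \<in> Fib T \<Gamma>. t \<Gamma> (k \<Gamma> s) = f \<Gamma> s \<and> l \<Gamma> (k \<Gamma> s) = g \<Gamma> s) \<longrightarrow>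
              (\<forall>\<Gamma> \<in> Obj C. \<forall>s \<in> Fib T \<Gamma>. k \<Gamma> s = h \<Gamma> s))"
proof -
  interpret category C by fact
  define Q where "Q \<Gamma> s w \<longleftrightarrow> w \<in> Fib W \<Gamma> \<and> t \<Gamma> w = f \<Gamma> s \<and> l \<Gamma> w = g \<Gamma> s" for \<Gamma> s w
  define h where "h \<Gamma> s = (THE w. Q \<Gamma> s w)" for \<Gamma> s
  have tm: "is_psh_map C W X t" and lm: "is_psh_map C W Y l"
    using pb by (auto simp: is_psh_pullback_def)
  have ex1: "\<exists>!w. Q \<Gamma> s w" if "\<Gamma> \<in> Obj C" "s \<in> Fib T \<Gamma>" for \<Gamma> s
  proof -
    have "f \<Gamma> s \<in> Fib X \<Gamma>" "g \<Gamma> s \<in> Fib Y \<Gamma>"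
      using f g that by (auto simp: is_psh_map_def)
    then show ?thesis
      using pb that comm[OF that] unfolding Q_def is_psh_pullback_def by blast
  qed
  have hQ: "Q \<Gamma> s (h \<Gamma> s)" if "\<Gamma> \<in> Obj C" "s \<in> Fib T \<Gamma>" for \<Gamma> s
    unfolding h_def using ex1[OF that] by (rule theI')
  have "h (Dom C \<sigma>) (Res T \<sigma> s) = Res W \<sigma> (h (Cod C \<sigma>) s)"
    if \<sigma>: "\<sigma> \<in> Arr C" and s: "s \<in> Fib T (Cod C \<sigma>)" for \<sigma> s
  proof -
    have s': "Res T \<sigma> s \<in> Fib T (Dom C \<sigma>)" using T \<sigma> s by (auto simp: is_presheaf_def)
    note Q1 = hQ[OF Cod_in[OF \<sigma>] s]
    have "Q (Dom C \<sigma>) (Res T \<sigma> s) (Res W \<sigma> (h (Cod C \<sigma>) s))"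
      using Q1 W tm lm f g \<sigma> s unfolding Q_def is_presheaf_def is_psh_map_def
      by (metis PiE)
    with ex1[OF Dom_in[OF \<sigma>] s'] hQ[OF Dom_in[OF \<sigma>] s'] show ?thesis by blast
  qed
  then have "is_psh_map C T W h" using hQ by (auto simp: is_psh_map_def Q_def)
  moreover have "k \<Gamma> s = h \<Gamma> s"
    if "is_psh_map C T W k"
      "\<forall>\<Gamma> \<in> Obj C. \<forall>s \<in> Fib T \<Gamma>. t \<Gamma> (k \<Gamma> s) = f \<Gamma> s \<and> l \<Gamma> (k \<Gamma> s) = g \<Gamma> s"
      and \<Gamma>: "\<Gamma> \<in> Obj C" and s: "s \<in> Fib T \<Gamma>" for k \<Gamma> s
  proof -
    have "Q \<Gamma> s (k \<Gamma> s)" using that by (auto simp: Q_def is_psh_map_def)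
    with ex1[OF \<Gamma> s] hQ[OF \<Gamma> s] show ?thesis by blast
  qed
  ultimately show ?thesis using hQ unfolding Q_def by blast
qed

lemma psh_pullback_if_universal:
  fixes C :: "('o, 'a) cat"
  assumes C: "category C"
    and W: "is_presheaf C W" and X: "is_presheaf C X" and Y: "is_presheaf C Y"
    and maps: "is_psh_map C W X t" "is_psh_map C W Y l" "is_psh_map C X Z r" "is_psh_map C Y Z b"
    and comm: "\<And>\<Gamma> w. \<Gamma> \<in> Obj C \<Longrightarrow> w \<in> Fib W \<Gamma> \<Longrightarrow> r \<Gamma> (t \<Gamma> w) = b \<Gamma> (l \<Gamma> w)"
    and univ: "\<And>(T :: ('o, 'a, 'a) psh) f g. is_presheaf C T \<Longrightarrow>
      is_psh_map C T X f \<Longrightarrow> is_psh_map C T Y g \<Longrightarrow>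
      (\<And>\<Gamma> s. \<Gamma> \<in> Obj C \<Longrightarrow> s \<in> Fib T \<Gamma> \<Longrightarrow> r \<Gamma> (f \<Gamma> s) = b \<Gamma> (g \<Gamma> s)) \<Longrightarrow>
      \<exists>h. (is_psh_map C T W h \<and>
           (\<forall>\<Gamma> \<in> Obj C. \<forall>s \<in> Fib T \<Gamma>. t \<Gamma> (h \<Gamma> s) = f \<Gamma> s \<and> l \<Gamma> (h \<Gamma> s) = g \<Gamma> s)) \<and>
          (\<forall>k. is_psh_map C T W k \<and>
           (\<forall>\<Gamma> \<in> Obj C. \<forall>s \<in> Fib T \<Gamma>. t \<Gamma> (k \<Gamma> s) = f \<Gamma> s \<and> l \<Gamma> (k \<Gamma> s) = g \<Gamma> s) \<longrightarrow>
           (\<forall>\<Gamma> \<in> Obj C. \<forall>s \<in> Fib T \<Gamma>. k \<Gamma> s = h \<Gamma> s))"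
  shows "is_psh_pullback C W X Y Z t l r b"
proof -
  interpret category C by fact
  have "\<exists>!w. w \<in> Fib W \<Gamma> \<and> t \<Gamma> w = x \<and> l \<Gamma> w = y"
    if \<Gamma>: "\<Gamma> \<in> Obj C" and x: "x \<in> Fib X \<Gamma>" and y: "y \<in> Fib Y \<Gamma>" and xy: "r \<Gamma> x = b \<Gamma> y" for \<Gamma> x y
  proof -
    let ?T = "yoneda C \<Gamma>"
    have idF: "Ident C \<Gamma> \<in> Fib ?T \<Gamma>" using Ident_in[OF \<Gamma>] by (simp add: yoneda_def)
    have e: "r \<Delta> (element_map X x \<Delta> s) = b \<Delta> (element_map Y y \<Delta> s)"
      if "\<Delta> \<in> Obj C" "s \<in> Fib ?T \<Delta>" for \<Delta> s
      using psh_map_Res[OF maps(3) that(2) x] psh_map_Res[OF maps(4) that(2) y] xy by (simp add: element_map_def)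
    obtain h where h: "is_psh_map C ?T W h"
      "\<forall>\<Delta> \<in> Obj C. \<forall>s \<in> Fib ?T \<Delta>.
         t \<Delta> (h \<Delta> s) = element_map X x \<Delta> s \<and> l \<Delta> (h \<Delta> s) = element_map Y y \<Delta> s"
      and uni: "\<And>k. is_psh_map C ?T W k \<Longrightarrow> (\<forall>\<Delta> \<in> Obj C. \<forall>s \<in> Fib ?T \<Delta>.
         t \<Delta> (k \<Delta> s) = element_map X x \<Delta> s \<and> l \<Delta> (k \<Delta> s) = element_map Y y \<Delta> s) \<Longrightarrow>
         (\<forall>\<Delta> \<in> Obj C. \<forall>s \<in> Fib ?T \<Delta>. k \<Delta> s = h \<Delta> s)"
      using univ[OF yoneda_presheaf[OF C] element_map_psh_map[OF X \<Gamma> x] element_map_psh_map[OF Y \<Gamma> y] e] by blast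
    show ?thesis
    proof (rule ex1I)
      show "h \<Gamma> (Ident C \<Gamma>) \<in> Fib W \<Gamma> \<and> t \<Gamma> (h \<Gamma> (Ident C \<Gamma>)) = x \<and> l \<Gamma> (h \<Gamma> (Ident C \<Gamma>)) = y"
        using h \<Gamma> idF presheaf_Ident[OF X \<Gamma> x] presheaf_Ident[OF Y \<Gamma> y] by (auto simp: is_psh_map_def element_map_def)
    next
      fix w assume w: "w \<in> Fib W \<Gamma> \<and> t \<Gamma> w = x \<and> l \<Gamma> w = y"
      have "t \<Delta> (element_map W w \<Delta> s) = element_map X x \<Delta> s \<and>
            l \<Delta> (element_map W w \<Delta> s) = element_map Y y \<Delta> s" if "s \<in> Fib ?T \<Delta>" for \<Delta> s
        using psh_map_Res[OF maps(1) that] psh_map_Res[OF maps(2) that] w by (simp add: element_map_def)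
      then have "element_map W w \<Gamma> (Ident C \<Gamma>) = h \<Gamma> (Ident C \<Gamma>)"
        using uni[OF element_map_psh_map[OF W \<Gamma>]] w \<Gamma> idF by blast
      then show "w = h \<Gamma> (Ident C \<Gamma>)" using presheaf_Ident[OF W \<Gamma>] w by (simp add: element_map_def)
    qed
  qed
  then show ?thesis using maps comm unfolding is_psh_pullback_def by blast
qed

text \<open>\<open>el C P\<close> is the category of elements. An arrow carries its endpoints, since one arrow \<open>\<sigma>\<close> of the
  base underlies many arrows \<open>(\<Delta>, y) \<rightarrow> (\<Gamma>, x)\<close>.\<close>

definition el ::
  "('o, 'a) cat \<Rightarrow> ('o, 'a, 'x) psh \<Rightarrow> ('o \<times> 'x, ('o \<times> 'x) \<times> 'a \<times> ('o \<times> 'x)) cat" where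
  "el C P =
     \<lparr> Obj = (SIGMA \<Gamma> : Obj C. Fib P \<Gamma>),
       Arr = {((\<Delta>, y), \<sigma>, (\<Gamma>, x)) | \<Delta> y \<sigma> \<Gamma> x.
                \<Delta> \<in> Obj C \<and> y \<in> Fib P \<Delta> \<and> \<Gamma> \<in> Obj C \<and> x \<in> Fib P \<Gamma> \<and>
                \<sigma> \<in> hom C \<Delta> \<Gamma> \<and> Res P \<sigma> x = y},
       Dom = (\<lambda>(Y, \<sigma>, X). Y),
       Cod = (\<lambda>(Y, \<sigma>, X). X),
       Ident = (\<lambda>(\<Gamma>, x). ((\<Gamma>, x), Ident C \<Gamma>, (\<Gamma>, x))),
       Comp = (\<lambda>(Y, \<sigma>, X) (Z, \<tau>, _). (Z, Comp C \<sigma> \<tau>, X)) \<rparr>"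

definition el_proj ::
  "('o, 'a) cat \<Rightarrow> ('o, 'a, 'x) psh \<Rightarrow> ('o \<times> 'x, ('o \<times> 'x) \<times> 'a \<times> ('o \<times> 'x), 'o, 'a) func" where
  "el_proj C P =
     \<lparr> omap = (\<lambda>(\<Gamma>, x) \<in> Obj (el C P). \<Gamma>),
       amap = (\<lambda>(Y, \<sigma>, X) \<in> Arr (el C P). \<sigma>) \<rparr>"

text \<open>The functor \<open>\<integral>\<alpha>\<close> for a map \<open>\<alpha>\<close> with source \<open>P\<close>.\<close>

definition el_map ::
  "('o, 'a) cat \<Rightarrow> ('o, 'a, 'x) psh \<Rightarrow> ('o \<Rightarrow> 'x \<Rightarrow> 'y) \<Rightarrow>
   ('o \<times> 'x, ('o \<times> 'x) \<times> 'a \<times> ('o \<times> 'x), 'o \<times> 'y, ('o \<times> 'y) \<times> 'a \<times> ('o \<times> 'y)) func" where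
  "el_map C P \<alpha> =
     \<lparr> omap = (\<lambda>(\<Gamma>, x) \<in> Obj (el C P). (\<Gamma>, \<alpha> \<Gamma> x)),
       amap = (\<lambda>((\<Delta>, y), \<sigma>, (\<Gamma>, x)) \<in> Arr (el C P). ((\<Delta>, \<alpha> \<Delta> y), \<sigma>, (\<Gamma>, \<alpha> \<Gamma> x))) \<rparr>"


lemma is_functorI:
  assumes "category C"
    and "omap F \<in> Obj C \<rightarrow>\<^sub>E Obj D" and "amap F \<in> extensional (Arr C)"
    and hom: "\<And>f X Y. f \<in> hom C X Y \<Longrightarrow> X \<in> Obj C \<Longrightarrow> Y \<in> Obj C \<Longrightarrow>
      amap F f \<in> hom D (omap F X) (omap F Y)"
    and "\<And>X. X \<in> Obj C \<Longrightarrow> amap F (Ident C X) = Ident D (omap F X)"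
    and "\<And>f g X Y Z. f \<in> hom C X Y \<Longrightarrow> g \<in> hom C Y Z \<Longrightarrow>
      amap F (Comp C g f) = Comp D (amap F g) (amap F f)"
  shows "is_functor C D F"
proof -
  interpret category C by fact
  have "amap F f \<in> hom D (omap F (Dom C f)) (omap F (Cod C f))" if "f \<in> Arr C" for f
    using that hom Dom_in Cod_in by (simp add: hom_def)
  then show ?thesis using assms unfolding is_functor_def by (auto simp: hom_def PiE_def)
qed

lemma Obj_el: "(\<Gamma>, x) \<in> Obj (el C P) \<longleftrightarrow> \<Gamma> \<in> Obj C \<and> x \<in> Fib P \<Gamma>"
  by (simp add: el_def)

lemma Arr_el: "((\<Delta>, y), \<sigma>, (\<Gamma>, x)) \<in> Arr (el C P) \<longleftrightarrow>
    \<Delta> \<in> Obj C \<and> y \<in> Fib P \<Delta> \<and> \<Gamma> \<in> Obj C \<and> x \<in> Fib P \<Gamma> \<and> \<sigma> \<in> hom C \<Delta> \<Gamma> \<and> Res P \<sigma> x = y"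
  by (auto simp: el_def)

lemma hom_elE:
  assumes "f \<in> hom (el C P) Y X"
  obtains \<Delta> y \<sigma> \<Gamma> x where "f = ((\<Delta>, y), \<sigma>, (\<Gamma>, x))" "Y = (\<Delta>, y)" "X = (\<Gamma>, x)"
    "((\<Delta>, y), \<sigma>, (\<Gamma>, x)) \<in> Arr (el C P)"
  using assms by (auto simp: el_def hom_def)

lemma hom_el: "((\<Delta>, y), \<sigma>, (\<Gamma>, x)) \<in> hom (el C P) Y X \<longleftrightarrow>
    Y = (\<Delta>, y) \<and> X = (\<Gamma>, x) \<and> ((\<Delta>, y), \<sigma>, (\<Gamma>, x)) \<in> Arr (el C P)"
  by (auto simp: el_def hom_def)

lemma el_sel:
  "Dom (el C P) (Y, \<sigma>, X) = Y" "Cod (el C P) (Y, \<sigma>, X) = X"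
  "Ident (el C P) (\<Gamma>, x) = ((\<Gamma>, x), Ident C \<Gamma>, (\<Gamma>, x))"
  "Comp (el C P) (Y', \<sigma>', X') (Z, \<tau>, W) = (Z, Comp C \<sigma>' \<tau>, X')"
  by (simp_all add: el_def)

lemma el_category:
  assumes C: "category C" and P: "is_presheaf C P"
  shows "category (el C P)"
proof -
  interpret category C by fact
  show ?thesis
  proof unfold_locales
    fix f X Y assume "f \<in> hom (el C P) X Y"
    then show "Comp (el C P) f (Ident (el C P) X) = f"
      and "Comp (el C P) (Ident (el C P) Y) f = f"
      by (auto elim!: hom_elE simp: el_sel Arr_el Comp_Ident Ident_Comp)
  next
    fix f g X Y Z assume "f \<in> hom (el C P) X Y" "g \<in> hom (el C P) Y Z"
    then show "Comp (el C P) g f \<in> hom (el C P) X Z"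
      by (auto elim!: hom_elE simp: el_sel Arr_el hom_el presheaf_Comp[OF P] intro: Comp_in)
  next
    fix f g h W X Y Z
    assume "f \<in> hom (el C P) W X" "g \<in> hom (el C P) X Y" "h \<in> hom (el C P) Y Z"
    then show "Comp (el C P) h (Comp (el C P) g f) = Comp (el C P) (Comp (el C P) h g) f"
      by (auto elim!: hom_elE simp: el_sel Arr_el intro: Comp_assoc)
  next
    fix X assume "X \<in> Obj (el C P)"
    then show "Ident (el C P) X \<in> hom (el C P) X X"
      by (cases X) (simp add: el_sel hom_el Arr_el Obj_el Ident_in presheaf_Ident[OF P])
  qed (auto simp: el_def)
qed

lemma el_proj_functor:
  assumes C: "category C" and P: "is_presheaf C P"
  shows "is_functor (el C P) C (el_proj C P)"
proof -
  interpret E: category "el C P" using assms by (rule el_category)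
  show ?thesis
  proof (rule is_functorI[OF E.category_axioms])
    fix X assume X: "X \<in> Obj (el C P)"
    then have "Ident (el C P) X \<in> Arr (el C P)" using E.Ident_in by (simp add: hom_def)
    with X show "amap (el_proj C P) (Ident (el C P) X) = Ident C (omap (el_proj C P) X)"
      by (cases X) (simp add: el_proj_def el_sel)
  next
    fix f g X Y Z assume fg: "f \<in> hom (el C P) X Y" "g \<in> hom (el C P) Y Z"
    then have "Comp (el C P) g f \<in> Arr (el C P)" using E.Comp_in by (simp add: hom_def)
    with fg show "amap (el_proj C P) (Comp (el C P) g f) =
        Comp C (amap (el_proj C P) g) (amap (el_proj C P) f)"
      by (auto elim!: hom_elE simp: el_proj_def el_sel)
  next
    fix f X Y assume "f \<in> hom (el C P) X Y" "X \<in> Obj (el C P)" "Y \<in> Obj (el C P)"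
    then show "amap (el_proj C P) f \<in> hom C (omap (el_proj C P) X) (omap (el_proj C P) Y)"
      by (auto elim!: hom_elE simp: el_proj_def Arr_el)
  qed (auto simp: el_proj_def Obj_el)
qed

lemma el_map_functor:
  assumes C: "category C" and P: "is_presheaf C P" and Q: "is_presheaf C Q"
    and \<alpha>: "is_psh_map C P Q \<alpha>"
  shows "is_functor (el C P) (el C Q) (el_map C P \<alpha>)"
proof -
  interpret E: category "el C P" using C P by (rule el_category)
  have nat: "\<alpha> \<Delta> (Res P \<sigma> x) = Res Q \<sigma> (\<alpha> \<Gamma> x)"
    if "\<sigma> \<in> hom C \<Delta> \<Gamma>" "x \<in> Fib P \<Gamma>" for \<Delta> \<Gamma> \<sigma> x
    using psh_map_Res[OF \<alpha>] that by (simp add: yoneda_def)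
  show ?thesis
  proof (rule is_functorI[OF E.category_axioms])
    fix X assume X: "X \<in> Obj (el C P)"
    then have "Ident (el C P) X \<in> Arr (el C P)" using E.Ident_in by (simp add: hom_def)
    with X show "amap (el_map C P \<alpha>) (Ident (el C P) X) = Ident (el C Q) (omap (el_map C P \<alpha>) X)"
      by (cases X) (simp add: el_map_def el_sel)
  next
    fix f g X Y Z assume fg: "f \<in> hom (el C P) X Y" "g \<in> hom (el C P) Y Z"
    then have "Comp (el C P) g f \<in> Arr (el C P)" using E.Comp_in by (simp add: hom_def)
    with fg show "amap (el_map C P \<alpha>) (Comp (el C P) g f) =
        Comp (el C Q) (amap (el_map C P \<alpha>) g) (amap (el_map C P \<alpha>) f)"
      by (auto elim!: hom_elE simp: el_map_def el_sel)
  next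
    fix f X Y assume "f \<in> hom (el C P) X Y" "X \<in> Obj (el C P)" "Y \<in> Obj (el C P)"
    then show "amap (el_map C P \<alpha>) f \<in>
        hom (el C Q) (omap (el_map C P \<alpha>) X) (omap (el_map C P \<alpha>) Y)"
      by (auto elim!: hom_elE simp: el_map_def hom_el Arr_el Obj_el nat psh_map_in[OF \<alpha>])
  qed (auto simp: el_map_def Obj_el psh_map_in[OF \<alpha>])
qed


section \<open>Natural models\<close>

text \<open>In the notation \<open>p : U\<^sup>\<bullet> \<rightarrow> U\<close>: \<open>Ty\<close> is \<open>U\<close>, \<open>Tm\<close> is \<open>U\<^sup>\<bullet>\<close>, \<open>typeof\<close> is \<open>p\<close>; \<open>ext M \<Gamma> A\<close> is
  \<open>\<Gamma> \<cdot> A\<close>, \<open>wk M \<Gamma> A\<close> is \<open>p\<^sub>A\<close> and \<open>vr M \<Gamma> A\<close> is \<open>q\<^sub>A\<close>. The object \<open>\<Gamma>\<close> is an explicit argument because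
  the fibres of a presheaf need not be disjoint.\<close>

record ('o, 'a, 'u, 'e) nmod =
  Base :: "('o, 'a) cat"
  Term :: "'o"
  Ty :: "('o, 'a, 'u) psh"
  Tm :: "('o, 'a, 'e) psh"
  typeof :: "'o \<Rightarrow> 'e \<Rightarrow> 'u"
  ext :: "'o \<Rightarrow> 'u \<Rightarrow> 'o"
  wk :: "'o \<Rightarrow> 'u \<Rightarrow> 'a"
  vr :: "'o \<Rightarrow> 'u \<Rightarrow> 'e"

locale natural_model =
  fixes M :: "('o, 'a, 'u, 'e) nmod"
  assumes base: "category (Base M)"
    and terminal: "is_terminal (Base M) (Term M)"
    and ty: "is_presheaf (Base M) (Ty M)"
    and tm: "is_presheaf (Base M) (Tm M)"
    and typeof: "is_psh_map (Base M) (Tm M) (Ty M) (typeof M)"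
    and ext_in: "\<Gamma> \<in> Obj (Base M) \<Longrightarrow> A \<in> Fib (Ty M) \<Gamma> \<Longrightarrow> ext M \<Gamma> A \<in> Obj (Base M)"
    and wk_in: "\<Gamma> \<in> Obj (Base M) \<Longrightarrow> A \<in> Fib (Ty M) \<Gamma> \<Longrightarrow>
      wk M \<Gamma> A \<in> hom (Base M) (ext M \<Gamma> A) \<Gamma>"
    and vr_in: "\<Gamma> \<in> Obj (Base M) \<Longrightarrow> A \<in> Fib (Ty M) \<Gamma> \<Longrightarrow>
      vr M \<Gamma> A \<in> Fib (Tm M) (ext M \<Gamma> A)"
    and pullback: "\<Gamma> \<in> Obj (Base M) \<Longrightarrow> A \<in> Fib (Ty M) \<Gamma> \<Longrightarrow>
      is_psh_pullback (Base M)
        (yoneda (Base M) (ext M \<Gamma> A)) (Tm M) (yoneda (Base M) \<Gamma>) (Ty M)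
        (element_map (Tm M) (vr M \<Gamma> A)) (yoneda_map (Base M) (wk M \<Gamma> A))
        (typeof M) (element_map (Ty M) A)"

abbreviation elTy where "elTy M \<equiv> el (Base M) (Ty M)"
abbreviation elTm where "elTm M \<equiv> el (Base M) (Tm M)"
abbreviation projTy where "projTy M \<equiv> el_proj (Base M) (Ty M)"
abbreviation projTm where "projTm M \<equiv> el_proj (Base M) (Tm M)"
abbreviation el_typeof where "el_typeof M \<equiv> el_map (Base M) (Tm M) (typeof M)"

text \<open>\<open>lift M \<Delta> \<sigma> a \<Gamma> A\<close> is the arrow \<open>\<Delta> \<rightarrow> \<Gamma> \<cdot> A\<close> induced by \<open>\<sigma> : \<Delta> \<rightarrow> \<Gamma>\<close> and \<open>a\<close> in \<open>U\<^sup>\<bullet>(\<Delta>)\<close> with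
  \<open>p(a) = A[\<sigma>]\<close>. The action of the right adjoint on \<open>\<sigma> : (\<Delta>, B) \<rightarrow> (\<Gamma>, A)\<close> is the arrow forced by
  naturality of the counit and by being an arrow \<open>(\<Delta> \<cdot> B, q\<^sub>B) \<rightarrow> (\<Gamma> \<cdot> A, q\<^sub>A)\<close>; see
  \<open>radj_adjunction\<close> below.\<close>

definition lift :: "('o, 'a, 'u, 'e) nmod \<Rightarrow> 'o \<Rightarrow> 'a \<Rightarrow> 'e \<Rightarrow> 'o \<Rightarrow> 'u \<Rightarrow> 'a" where
  "lift M \<Delta> \<sigma> a \<Gamma> A =
     (THE \<tau>. \<tau> \<in> hom (Base M) \<Delta> (ext M \<Gamma> A) \<and>
        Comp (Base M) (wk M \<Gamma> A) \<tau> = \<sigma> \<and> Res (Tm M) \<tau> (vr M \<Gamma> A) = a)"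

definition radj ::
  "('o, 'a, 'u, 'e) nmod \<Rightarrow>
   ('o \<times> 'u, ('o \<times> 'u) \<times> 'a \<times> ('o \<times> 'u), 'o \<times> 'e, ('o \<times> 'e) \<times> 'a \<times> ('o \<times> 'e)) func" where
  "radj M =
     \<lparr> omap = (\<lambda>(\<Gamma>, A) \<in> Obj (elTy M). (ext M \<Gamma> A, vr M \<Gamma> A)),
       amap = (\<lambda>((\<Delta>, B), \<sigma>, (\<Gamma>, A)) \<in> Arr (elTy M).
         ((ext M \<Delta> B, vr M \<Delta> B),
          lift M (ext M \<Delta> B) (Comp (Base M) \<sigma> (wk M \<Delta> B)) (vr M \<Delta> B) \<Gamma> A,
          (ext M \<Gamma> A, vr M \<Gamma> A))) \<rparr>"

definition adj_unit ::
  "('o, 'a, 'u, 'e) nmod \<Rightarrow> 'o \<times> 'e \<Rightarrow> ('o \<times> 'e) \<times> 'a \<times> ('o \<times> 'e)" where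
  "adj_unit M = (\<lambda>(\<Gamma>, a) \<in> Obj (elTm M).
     let A = typeof M \<Gamma> a in
     ((\<Gamma>, a), lift M \<Gamma> (Ident (Base M) \<Gamma>) a \<Gamma> A, (ext M \<Gamma> A, vr M \<Gamma> A)))"

definition adj_counit ::
  "('o, 'a, 'u, 'e) nmod \<Rightarrow> 'o \<times> 'u \<Rightarrow> ('o \<times> 'u) \<times> 'a \<times> ('o \<times> 'u)" where
  "adj_counit M = (\<lambda>(\<Gamma>, A) \<in> Obj (elTy M).
     ((ext M \<Gamma> A, typeof M (ext M \<Gamma> A) (vr M \<Gamma> A)), wk M \<Gamma> A, (\<Gamma>, A)))"


context natural_model
begin

sublocale B: category "Base M" by (rule base)

abbreviation "Ctx \<equiv> Obj (Base M)"
abbreviation "Tyf \<equiv> Fib (Ty M)"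
abbreviation "Tmf \<equiv> Fib (Tm M)"
abbreviation "lifts \<Delta> \<sigma> a \<Gamma> A \<tau> \<equiv> \<tau> \<in> hom (Base M) \<Delta> (ext M \<Gamma> A) \<and>
  Comp (Base M) (wk M \<Gamma> A) \<tau> = \<sigma> \<and> Res (Tm M) \<tau> (vr M \<Gamma> A) = a"

lemma lift_ex1:
  assumes "\<Gamma> \<in> Ctx" "A \<in> Tyf \<Gamma>" "\<Delta> \<in> Ctx" "\<sigma> \<in> hom (Base M) \<Delta> \<Gamma>" "a \<in> Tmf \<Delta>"
    and "typeof M \<Delta> a = Res (Ty M) \<sigma> A"
  shows "\<exists>!\<tau>. lifts \<Delta> \<sigma> a \<Gamma> A \<tau>"
proof -
  have "\<forall>x \<in> Tmf \<Delta>. \<forall>y \<in> hom (Base M) \<Delta> \<Gamma>. typeof M \<Delta> x = Res (Ty M) y A \<longrightarrow>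
      (\<exists>!w. w \<in> hom (Base M) \<Delta> (ext M \<Gamma> A) \<and> Res (Tm M) w (vr M \<Gamma> A) = x \<and>
        Comp (Base M) (wk M \<Gamma> A) w = y)"
    using pullback[OF assms(1,2)] assms(3)
    unfolding is_psh_pullback_def yoneda_def yoneda_map_def element_map_def by simp
  then have "\<exists>!w. w \<in> hom (Base M) \<Delta> (ext M \<Gamma> A) \<and> Res (Tm M) w (vr M \<Gamma> A) = a \<and>
        Comp (Base M) (wk M \<Gamma> A) w = \<sigma>"
    using assms by blast
  then show ?thesis by (simp add: conj_commute)
qed

lemma lift_lifts:
  assumes "\<Gamma> \<in> Ctx" "A \<in> Tyf \<Gamma>" "\<Delta> \<in> Ctx" "\<sigma> \<in> hom (Base M) \<Delta> \<Gamma>" "a \<in> Tmf \<Delta>"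
    and "typeof M \<Delta> a = Res (Ty M) \<sigma> A"
  shows "lifts \<Delta> \<sigma> a \<Gamma> A (lift M \<Delta> \<sigma> a \<Gamma> A)"
  unfolding lift_def using lift_ex1[OF assms] by (rule theI')

lemma arrow_into_ext_eqI:
  assumes "\<Gamma> \<in> Ctx" "A \<in> Tyf \<Gamma>"
    and \<tau>: "\<tau> \<in> hom (Base M) \<Delta> (ext M \<Gamma> A)" and \<tau>': "\<tau>' \<in> hom (Base M) \<Delta> (ext M \<Gamma> A)"
    and wk: "Comp (Base M) (wk M \<Gamma> A) \<tau> = Comp (Base M) (wk M \<Gamma> A) \<tau>'"
    and vr: "Res (Tm M) \<tau> (vr M \<Gamma> A) = Res (Tm M) \<tau>' (vr M \<Gamma> A)"
  shows "\<tau> = \<tau>'"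
proof -
  have \<Delta>: "\<Delta> \<in> Ctx" using \<tau> B.Dom_in by (auto simp: hom_def)
  have v: "vr M \<Gamma> A \<in> Tmf (ext M \<Gamma> A)" and w: "wk M \<Gamma> A \<in> hom (Base M) (ext M \<Gamma> A) \<Gamma>"
    using assms vr_in wk_in by auto
  have a: "Res (Tm M) \<tau> (vr M \<Gamma> A) \<in> Tmf \<Delta>" by (rule presheaf_Res_in[OF tm \<tau> v])
  have s: "Comp (Base M) (wk M \<Gamma> A) \<tau> \<in> hom (Base M) \<Delta> \<Gamma>" by (rule B.Comp_in[OF \<tau> w])
  have c: "\<forall>w \<in> hom (Base M) \<Delta> (ext M \<Gamma> A). typeof M \<Delta> (Res (Tm M) w (vr M \<Gamma> A)) =
      Res (Ty M) (Comp (Base M) (wk M \<Gamma> A) w) A"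
    using pullback[OF assms(1,2)] \<Delta>
    unfolding is_psh_pullback_def yoneda_def yoneda_map_def element_map_def by simp
  from lift_ex1[OF assms(1,2) \<Delta> s a] c \<tau> \<tau>' wk vr show ?thesis by metis
qed

lemma typeof_Res:
  assumes "\<sigma> \<in> hom (Base M) \<Delta> \<Gamma>" "a \<in> Tmf \<Gamma>"
  shows "typeof M \<Delta> (Res (Tm M) \<sigma> a) = Res (Ty M) \<sigma> (typeof M \<Gamma> a)"
  using psh_map_Res[OF typeof] assms by (simp add: yoneda_def)

lemma typeof_vr:
  assumes "\<Gamma> \<in> Ctx" "A \<in> Tyf \<Gamma>"
  shows "typeof M (ext M \<Gamma> A) (vr M \<Gamma> A) = Res (Ty M) (wk M \<Gamma> A) A"
proof -
  have "\<forall>w \<in> hom (Base M) (ext M \<Gamma> A) (ext M \<Gamma> A).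
      typeof M (ext M \<Gamma> A) (Res (Tm M) w (vr M \<Gamma> A)) =
      Res (Ty M) (Comp (Base M) (wk M \<Gamma> A) w) A"
    using pullback[OF assms] ext_in[OF assms]
    unfolding is_psh_pullback_def yoneda_def yoneda_map_def element_map_def by simp
  from this[rule_format, OF B.Ident_in[OF ext_in[OF assms]]] show ?thesis
    using presheaf_Ident[OF tm ext_in[OF assms] vr_in[OF assms]] B.Comp_Ident[OF wk_in[OF assms]]
    by simp
qed

lemma typeof_in: "\<Gamma> \<in> Ctx \<Longrightarrow> a \<in> Tmf \<Gamma> \<Longrightarrow> typeof M \<Gamma> a \<in> Tyf \<Gamma>"
  by (rule psh_map_in[OF typeof])

lemma el_arrow_lifts:
  assumes "((\<Delta>, B), \<sigma>, (\<Gamma>, A)) \<in> Arr (elTy M)"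
  shows "lifts (ext M \<Delta> B) (Comp (Base M) \<sigma> (wk M \<Delta> B)) (vr M \<Delta> B) \<Gamma> A
    (lift M (ext M \<Delta> B) (Comp (Base M) \<sigma> (wk M \<Delta> B)) (vr M \<Delta> B) \<Gamma> A)"
proof -
  have A: "\<Delta> \<in> Ctx" "B \<in> Tyf \<Delta>" "\<Gamma> \<in> Ctx" "A \<in> Tyf \<Gamma>" "\<sigma> \<in> hom (Base M) \<Delta> \<Gamma>"
    "Res (Ty M) \<sigma> A = B" using assms by (auto simp: Arr_el)
  note w = wk_in[OF A(1,2)]
  have "typeof M (ext M \<Delta> B) (vr M \<Delta> B) = Res (Ty M) (Comp (Base M) \<sigma> (wk M \<Delta> B)) A"
    using presheaf_Comp[OF ty w A(5,4)] typeof_vr[OF A(1,2)] A(6) by simp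
  then show ?thesis using A w by (intro lift_lifts) (auto intro: ext_in vr_in B.Comp_in)
qed

lemma unit_lifts:
  assumes "\<Gamma> \<in> Ctx" "a \<in> Tmf \<Gamma>"
  shows "lifts \<Gamma> (Ident (Base M) \<Gamma>) a \<Gamma> (typeof M \<Gamma> a)
    (lift M \<Gamma> (Ident (Base M) \<Gamma>) a \<Gamma> (typeof M \<Gamma> a))"
  using assms
  by (intro lift_lifts) (auto simp: presheaf_Ident[OF ty] typeof_in B.Ident_in)

lemma radj_functor: "is_functor (elTy M) (elTm M) (radj M)"
proof -
  interpret E: category "elTy M" using base ty by (rule el_category)
  show ?thesis
  proof (rule is_functorI[OF E.category_axioms])
    show "omap (radj M) \<in> Obj (elTy M) \<rightarrow>\<^sub>E Obj (elTm M)"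
      by (auto simp: radj_def Obj_el ext_in vr_in)
  next
    fix f X Y assume "f \<in> hom (elTy M) X Y" "X \<in> Obj (elTy M)" "Y \<in> Obj (elTy M)"
    then show "amap (radj M) f \<in> hom (elTm M) (omap (radj M) X) (omap (radj M) Y)"
      using el_arrow_lifts
      by (auto elim!: hom_elE simp: radj_def hom_el Obj_el) (auto simp: Arr_el ext_in vr_in)
  next
    fix X assume X: "X \<in> Obj (elTy M)"
    then obtain \<Gamma> A where XA: "X = (\<Gamma>, A)" "\<Gamma> \<in> Ctx" "A \<in> Tyf \<Gamma>" by (cases X) (auto simp: Obj_el)
    have "Ident (elTy M) X \<in> Arr (elTy M)" using E.Ident_in X by (simp add: hom_def)
    then have i: "((\<Gamma>, A), Ident (Base M) \<Gamma>, (\<Gamma>, A)) \<in> Arr (elTy M)" by (simp add: XA el_sel)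
    have "lift M (ext M \<Gamma> A) (Comp (Base M) (Ident (Base M) \<Gamma>) (wk M \<Gamma> A)) (vr M \<Gamma> A) \<Gamma> A =
        Ident (Base M) (ext M \<Gamma> A)"
    proof (rule arrow_into_ext_eqI[OF XA(2,3)])
      note l = el_arrow_lifts[OF i] and w = wk_in[OF XA(2,3)] and e = ext_in[OF XA(2,3)]
      let ?i = "lift M (ext M \<Gamma> A) (Comp (Base M) (Ident (Base M) \<Gamma>) (wk M \<Gamma> A)) (vr M \<Gamma> A) \<Gamma> A"
      show "?i \<in> hom (Base M) (ext M \<Gamma> A) (ext M \<Gamma> A)" using l by blast
      show "Ident (Base M) (ext M \<Gamma> A) \<in> hom (Base M) (ext M \<Gamma> A) (ext M \<Gamma> A)"
        by (rule B.Ident_in[OF e])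
      show "Comp (Base M) (wk M \<Gamma> A) ?i = Comp (Base M) (wk M \<Gamma> A) (Ident (Base M) (ext M \<Gamma> A))"
        using l B.Ident_Comp[OF w] B.Comp_Ident[OF w] by metis
      show "Res (Tm M) ?i (vr M \<Gamma> A) = Res (Tm M) (Ident (Base M) (ext M \<Gamma> A)) (vr M \<Gamma> A)"
        using l presheaf_Ident[OF tm e vr_in[OF XA(2,3)]] by metis
    qed
    with i X show "amap (radj M) (Ident (elTy M) X) = Ident (elTm M) (omap (radj M) X)"
      by (simp add: XA el_sel radj_def)
  next
    fix f g X Y Z assume fg: "f \<in> hom (elTy M) X Y" "g \<in> hom (elTy M) Y Z"
    then have "Comp (elTy M) g f \<in> Arr (elTy M)" using E.Comp_in by (simp add: hom_def)
    with fg obtain \<Theta> C \<tau> \<Delta> B \<sigma> \<Gamma> A where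
      f: "f = ((\<Theta>, C), \<tau>, (\<Delta>, B))" "f \<in> Arr (elTy M)" and
      g: "g = ((\<Delta>, B), \<sigma>, (\<Gamma>, A))" "g \<in> Arr (elTy M)" and
      gf: "((\<Theta>, C), Comp (Base M) \<sigma> \<tau>, (\<Gamma>, A)) \<in> Arr (elTy M)"
      by (auto elim!: hom_elE simp: el_sel)
    note lf = el_arrow_lifts[OF f(2)[unfolded f(1)]]
    note lg = el_arrow_lifts[OF g(2)[unfolded g(1)]]
    note lgf = el_arrow_lifts[OF gf]
    let ?f = "lift M (ext M \<Theta> C) (Comp (Base M) \<tau> (wk M \<Theta> C)) (vr M \<Theta> C) \<Delta> B"
    let ?g = "lift M (ext M \<Delta> B) (Comp (Base M) \<sigma> (wk M \<Delta> B)) (vr M \<Delta> B) \<Gamma> A"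
    have A: "\<Gamma> \<in> Ctx" "A \<in> Tyf \<Gamma>" "\<Delta> \<in> Ctx" "B \<in> Tyf \<Delta>" "\<Theta> \<in> Ctx" "C \<in> Tyf \<Theta>"
      "\<sigma> \<in> hom (Base M) \<Delta> \<Gamma>" "\<tau> \<in> hom (Base M) \<Theta> \<Delta>"
      using f g by (auto simp: Arr_el)
    have "Comp (Base M) (wk M \<Gamma> A) (Comp (Base M) ?g ?f) =
        Comp (Base M) (Comp (Base M) (wk M \<Gamma> A) ?g) ?f"
      using lf lg wk_in[OF A(1,2)] by (intro B.Comp_assoc) auto
    also have "\<dots> = Comp (Base M) (Comp (Base M) \<sigma> (wk M \<Delta> B)) ?f" using lg by simp
    also have "\<dots> = Comp (Base M) \<sigma> (Comp (Base M) (wk M \<Delta> B) ?f)"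
      using lf wk_in[OF A(3,4)] A(7) by (intro B.Comp_assoc[symmetric]) auto
    also have "\<dots> = Comp (Base M) \<sigma> (Comp (Base M) \<tau> (wk M \<Theta> C))" using lf by simp
    also have "\<dots> = Comp (Base M) (Comp (Base M) \<sigma> \<tau>) (wk M \<Theta> C)"
      using wk_in[OF A(5,6)] A(7,8) by (intro B.Comp_assoc) auto
    finally have w: "Comp (Base M) (wk M \<Gamma> A) (Comp (Base M) ?g ?f) = \<dots>" .
    have v: "Res (Tm M) (Comp (Base M) ?g ?f) (vr M \<Gamma> A) = vr M \<Theta> C"
      using lf lg vr_in[OF A(1,2)] by (subst presheaf_Comp[OF tm]) auto
    have "Comp (Base M) ?g ?f \<in> hom (Base M) (ext M \<Theta> C) (ext M \<Gamma> A)"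
      using lf lg by (blast intro: B.Comp_in)
    then have "lift M (ext M \<Theta> C) (Comp (Base M) (Comp (Base M) \<sigma> \<tau>) (wk M \<Theta> C))
        (vr M \<Theta> C) \<Gamma> A = Comp (Base M) ?g ?f"
      by (rule arrow_into_ext_eqI[OF A(1,2) conjunct1[OF lgf] _
            trans[OF conjunct1[OF conjunct2[OF lgf]] w[symmetric]]
            trans[OF conjunct2[OF conjunct2[OF lgf]] v[symmetric]]])
    with f g gf show "amap (radj M) (Comp (elTy M) g f) =
        Comp (elTm M) (amap (radj M) g) (amap (radj M) f)"
      by (simp add: radj_def el_sel)
  qed (auto simp: radj_def)
qed

lemma el_typeof_functor: "is_functor (elTm M) (elTy M) (el_typeof M)"
  by (rule el_map_functor[OF base tm ty typeof])

theorem radj_adjunction: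
  "is_adjunction (elTm M) (elTy M) (el_typeof M) (radj M) (adj_unit M) (adj_counit M)"
proof -
  interpret E: category "elTy M" using base ty by (rule el_category)
  interpret E': category "elTm M" using base tm by (rule el_category)
  have unit: "is_nat_trans (elTm M) (elTm M) (func_id (elTm M))
      (func_comp (elTm M) (radj M) (el_typeof M)) (adj_unit M)"
    unfolding is_nat_trans_def
  proof (intro conjI ballI)
    show "adj_unit M \<in> (\<Pi>\<^sub>E X \<in> Obj (elTm M). hom (elTm M) (omap (func_id (elTm M)) X)
        (omap (func_comp (elTm M) (radj M) (el_typeof M)) X))"
      using unit_lifts
      by (auto simp: adj_unit_def func_id_def func_comp_def radj_def el_map_def Obj_el hom_el Let_def
          Arr_el ext_in vr_in typeof_in)
  next
    fix f assume f: "f \<in> Arr (elTm M)"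
    then obtain \<Delta> b \<sigma> \<Gamma> a where fe: "f = ((\<Delta>, b), \<sigma>, (\<Gamma>, a))" by (metis prod.collapse)
    have A: "\<Delta> \<in> Ctx" "b \<in> Tmf \<Delta>" "\<Gamma> \<in> Ctx" "a \<in> Tmf \<Gamma>" "\<sigma> \<in> hom (Base M) \<Delta> \<Gamma>"
      "Res (Tm M) \<sigma> a = b" using f by (auto simp: fe Arr_el)
    let ?A = "typeof M \<Gamma> a" and ?B = "typeof M \<Delta> b"
    have T: "?A \<in> Tyf \<Gamma>" "?B \<in> Tyf \<Delta>" using A typeof_in by auto
    have g: "((\<Delta>, ?B), \<sigma>, (\<Gamma>, ?A)) \<in> Arr (elTy M)" using A T typeof_Res by (auto simp: Arr_el)
    let ?g = "lift M (ext M \<Delta> ?B) (Comp (Base M) \<sigma> (wk M \<Delta> ?B)) (vr M \<Delta> ?B) \<Gamma> ?A"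
    let ?u = "lift M \<Gamma> (Ident (Base M) \<Gamma>) a \<Gamma> ?A" and ?v = "lift M \<Delta> (Ident (Base M) \<Delta>) b \<Delta> ?B"
    note lg = el_arrow_lifts[OF g]
    note lu = unit_lifts[OF A(3,4)] and lv = unit_lifts[OF A(1,2)]
    have wA: "wk M \<Gamma> ?A \<in> hom (Base M) (ext M \<Gamma> ?A) \<Gamma>"
      and wB: "wk M \<Delta> ?B \<in> hom (Base M) (ext M \<Delta> ?B) \<Delta>" using A T wk_in by auto
    have "Comp (Base M) ?u \<sigma> = Comp (Base M) ?g ?v"
    proof (rule arrow_into_ext_eqI[OF A(3) T(1)])
      show "Comp (Base M) ?u \<sigma> \<in> hom (Base M) \<Delta> (ext M \<Gamma> ?A)"
        using lu A by (blast intro: B.Comp_in)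
      show "Comp (Base M) ?g ?v \<in> hom (Base M) \<Delta> (ext M \<Gamma> ?A)"
        using lg lv by (blast intro: B.Comp_in)
      have "Comp (Base M) (wk M \<Gamma> ?A) (Comp (Base M) ?u \<sigma>) = \<sigma>"
        using B.Comp_assoc[OF A(5) conjunct1[OF lu] wA] lu B.Ident_Comp[OF A(5)] by simp
      moreover have "Comp (Base M) (wk M \<Gamma> ?A) (Comp (Base M) ?g ?v) = \<sigma>"
        using B.Comp_assoc[OF conjunct1[OF lv] conjunct1[OF lg] wA] lg lv
          B.Comp_assoc[OF conjunct1[OF lv] wB A(5)] B.Comp_Ident[OF A(5)] by simp
      ultimately show "Comp (Base M) (wk M \<Gamma> ?A) (Comp (Base M) ?u \<sigma>) =
          Comp (Base M) (wk M \<Gamma> ?A) (Comp (Base M) ?g ?v)" by simp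
      have "Res (Tm M) (Comp (Base M) ?u \<sigma>) (vr M \<Gamma> ?A) = b"
        using presheaf_Comp[OF tm A(5) conjunct1[OF lu] vr_in[OF A(3) T(1)]] lu A by simp
      moreover have "Res (Tm M) (Comp (Base M) ?g ?v) (vr M \<Gamma> ?A) = b"
        using presheaf_Comp[OF tm conjunct1[OF lv] conjunct1[OF lg] vr_in[OF A(3) T(1)]] lg lv
        by simp
      ultimately show "Res (Tm M) (Comp (Base M) ?u \<sigma>) (vr M \<Gamma> ?A) =
          Res (Tm M) (Comp (Base M) ?g ?v) (vr M \<Gamma> ?A)" by simp
    qed
    with f g A T show "Comp (elTm M) (adj_unit M (Cod (elTm M) f)) (amap (func_id (elTm M)) f) =
        Comp (elTm M) (amap (func_comp (elTm M) (radj M) (el_typeof M)) f)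
          (adj_unit M (Dom (elTm M) f))"
      by (simp add: fe adj_unit_def func_id_def func_comp_def radj_def el_map_def Obj_el el_sel
          Let_def)
  qed
  have counit: "is_nat_trans (elTy M) (elTy M) (func_comp (elTy M) (el_typeof M) (radj M))
      (func_id (elTy M)) (adj_counit M)"
    unfolding is_nat_trans_def
  proof (intro conjI ballI)
    show "adj_counit M \<in> (\<Pi>\<^sub>E X \<in> Obj (elTy M). hom (elTy M)
        (omap (func_comp (elTy M) (el_typeof M) (radj M)) X) (omap (func_id (elTy M)) X))"
      by (auto simp: adj_counit_def func_id_def func_comp_def radj_def el_map_def Obj_el hom_el
          Arr_el ext_in vr_in typeof_in wk_in typeof_vr[symmetric])
  next
    fix f assume f: "f \<in> Arr (elTy M)"
    then obtain \<Delta> B \<sigma> \<Gamma> A where fe: "f = ((\<Delta>, B), \<sigma>, (\<Gamma>, A))" by (metis prod.collapse)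
    have A: "\<Delta> \<in> Ctx" "B \<in> Tyf \<Delta>" "\<Gamma> \<in> Ctx" "A \<in> Tyf \<Gamma>"
      using f by (auto simp: fe Arr_el)
    note l = el_arrow_lifts[OF f[unfolded fe]]
    have "amap (radj M) f \<in> Arr (elTm M)" using radj_functor f by (auto simp: is_functor_def)
    with f l A show "Comp (elTy M) (adj_counit M (Cod (elTy M) f))
          (amap (func_comp (elTy M) (el_typeof M) (radj M)) f) =
        Comp (elTy M) (amap (func_id (elTy M)) f) (adj_counit M (Dom (elTy M) f))"
      by (simp add: fe adj_counit_def func_id_def func_comp_def radj_def el_map_def Obj_el el_sel)
  qed
  have tri1: "Comp (elTy M) (adj_counit M (omap (el_typeof M) X)) (amap (el_typeof M) (adj_unit M X)) =
      Ident (elTy M) (omap (el_typeof M) X)" if X: "X \<in> Obj (elTm M)" for X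
  proof -
    obtain \<Gamma> a where Xe: "X = (\<Gamma>, a)" "\<Gamma> \<in> Ctx" "a \<in> Tmf \<Gamma>" using X by (cases X) (auto simp: Obj_el)
    note l = unit_lifts[OF Xe(2,3)]
    have "adj_unit M X \<in> Arr (elTm M)"
      using l Xe by (simp add: adj_unit_def Obj_el Arr_el Let_def typeof_in ext_in vr_in)
    then show ?thesis using l Xe
      by (simp add: adj_unit_def adj_counit_def el_map_def Obj_el el_sel Let_def typeof_in)
  qed
  have tri2: "Comp (elTm M) (amap (radj M) (adj_counit M Y)) (adj_unit M (omap (radj M) Y)) =
      Ident (elTm M) (omap (radj M) Y)" if Y: "Y \<in> Obj (elTy M)" for Y
  proof -
    obtain \<Gamma> A where Ye: "Y = (\<Gamma>, A)" "\<Gamma> \<in> Ctx" "A \<in> Tyf \<Gamma>" using Y by (cases Y) (auto simp: Obj_el)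
    let ?D = "ext M \<Gamma> A" let ?q = "vr M \<Gamma> A" let ?B = "typeof M ?D ?q"
    have D: "?D \<in> Ctx" "?q \<in> Tmf ?D" "?B \<in> Tyf ?D" using Ye ext_in vr_in typeof_in by auto
    have w: "wk M \<Gamma> A \<in> hom (Base M) ?D \<Gamma>" and wB: "wk M ?D ?B \<in> hom (Base M) (ext M ?D ?B) ?D"
      using Ye D wk_in by auto
    have c: "((?D, ?B), wk M \<Gamma> A, (\<Gamma>, A)) \<in> Arr (elTy M)"
      using Ye D w typeof_vr by (simp add: Arr_el)
    let ?g = "lift M (ext M ?D ?B) (Comp (Base M) (wk M \<Gamma> A) (wk M ?D ?B)) (vr M ?D ?B) \<Gamma> A"
    let ?u = "lift M ?D (Ident (Base M) ?D) ?q ?D ?B"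
    note lg = el_arrow_lifts[OF c] and lu = unit_lifts[OF D(1,2)]
    have "Comp (Base M) ?g ?u = Ident (Base M) ?D"
    proof (rule arrow_into_ext_eqI[OF Ye(2,3)])
      show "Comp (Base M) ?g ?u \<in> hom (Base M) ?D ?D" using lg lu by (blast intro: B.Comp_in)
      show "Ident (Base M) ?D \<in> hom (Base M) ?D ?D" using D B.Ident_in by blast
      show "Comp (Base M) (wk M \<Gamma> A) (Comp (Base M) ?g ?u) =
          Comp (Base M) (wk M \<Gamma> A) (Ident (Base M) ?D)"
        using B.Comp_assoc[OF conjunct1[OF lu] conjunct1[OF lg] w] lg lu
          B.Comp_assoc[OF conjunct1[OF lu] wB w] by simp
      show "Res (Tm M) (Comp (Base M) ?g ?u) ?q = Res (Tm M) (Ident (Base M) ?D) ?q"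
        using presheaf_Comp[OF tm conjunct1[OF lu] conjunct1[OF lg] D(2)] lg lu
          presheaf_Ident[OF tm D(1,2)] by simp
    qed
    with c Ye D show ?thesis
      by (simp add: adj_unit_def adj_counit_def radj_def Obj_el el_sel Let_def)
  qed
  show ?thesis
    unfolding is_adjunction_def
    by (intro conjI ballI el_typeof_functor radj_functor unit counit tri1 tri2)
qed

end


section \<open>Morphisms of natural models\<close>

record ('o, 'a, 'u, 'e, 'p, 'b, 'v, 'f) nmor =
  mbase :: "('o, 'a, 'p, 'b) func"
  mty :: "'o \<Rightarrow> 'u \<Rightarrow> 'v"
  mtm :: "'o \<Rightarrow> 'e \<Rightarrow> 'f"

definition is_nm_morphism ::
  "('o, 'a, 'u, 'e) nmod \<Rightarrow> ('p, 'b, 'v, 'f) nmod \<Rightarrow>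
   ('o, 'a, 'u, 'e, 'p, 'b, 'v, 'f) nmor \<Rightarrow> bool" where
  "is_nm_morphism M N F \<longleftrightarrow>
     is_functor (Base M) (Base N) (mbase F) \<and>
     omap (mbase F) (Term M) = Term N \<and>
     mty F \<in> (\<Pi>\<^sub>E \<Gamma> \<in> Obj (Base M). Fib (Ty M) \<Gamma> \<rightarrow>\<^sub>E Fib (Ty N) (omap (mbase F) \<Gamma>)) \<and>
     mtm F \<in> (\<Pi>\<^sub>E \<Gamma> \<in> Obj (Base M). Fib (Tm M) \<Gamma> \<rightarrow>\<^sub>E Fib (Tm N) (omap (mbase F) \<Gamma>)) \<and>
     (\<forall>\<Delta> \<Gamma>. \<forall>\<sigma> \<in> hom (Base M) \<Delta> \<Gamma>.
        (\<forall>A \<in> Fib (Ty M) \<Gamma>.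
           mty F \<Delta> (Res (Ty M) \<sigma> A) = Res (Ty N) (amap (mbase F) \<sigma>) (mty F \<Gamma> A)) \<and>
        (\<forall>a \<in> Fib (Tm M) \<Gamma>.
           mtm F \<Delta> (Res (Tm M) \<sigma> a) = Res (Tm N) (amap (mbase F) \<sigma>) (mtm F \<Gamma> a))) \<and>
     (\<forall>\<Gamma> \<in> Obj (Base M). \<forall>a \<in> Fib (Tm M) \<Gamma>.
        typeof N (omap (mbase F) \<Gamma>) (mtm F \<Gamma> a) = mty F \<Gamma> (typeof M \<Gamma> a)) \<and>
     (\<forall>\<Gamma> \<in> Obj (Base M). \<forall>A \<in> Fib (Ty M) \<Gamma>.
        omap (mbase F) (ext M \<Gamma> A) = ext N (omap (mbase F) \<Gamma>) (mty F \<Gamma> A) \<and>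
        amap (mbase F) (wk M \<Gamma> A) = wk N (omap (mbase F) \<Gamma>) (mty F \<Gamma> A) \<and>
        mtm F (ext M \<Gamma> A) (vr M \<Gamma> A) = vr N (omap (mbase F) \<Gamma>) (mty F \<Gamma> A))"

text \<open>The functor \<open>(\<Gamma>, x) \<mapsto> (F \<Gamma>, F x)\<close>, \<open>\<sigma> \<mapsto> F \<sigma>\<close> between categories of elements.\<close>

definition el_func ::
  "('o, 'a) cat \<Rightarrow> ('o, 'a, 'x) psh \<Rightarrow> ('o, 'a, 'p, 'b) func \<Rightarrow> ('o \<Rightarrow> 'x \<Rightarrow> 'y) \<Rightarrow>
   ('o \<times> 'x, ('o \<times> 'x) \<times> 'a \<times> ('o \<times> 'x), 'p \<times> 'y, ('p \<times> 'y) \<times> 'b \<times> ('p \<times> 'y)) func" where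
  "el_func C P F \<phi> =
     \<lparr> omap = (\<lambda>(\<Gamma>, x) \<in> Obj (el C P). (omap F \<Gamma>, \<phi> \<Gamma> x)),
       amap = (\<lambda>((\<Delta>, y), \<sigma>, (\<Gamma>, x)) \<in> Arr (el C P).
         ((omap F \<Delta>, \<phi> \<Delta> y), amap F \<sigma>, (omap F \<Gamma>, \<phi> \<Gamma> x))) \<rparr>"

end

theory Submission
  imports Defs
begin

text \<open>A functor between categories of elements lying over \<open>F\<close> is the same as a natural family of
  maps \<open>P(\<Gamma>) \<rightarrow> Q(F \<Gamma>)\<close>. Under this correspondence the square with \<open>\<integral>p\<close> and \<open>\<integral>q\<close> says that the
  families respect typing, and the conditions on \<open>p\<^sup>*\<close>, \<open>q\<^sup>*\<close> (on objects) and on the counits say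
  that \<open>\<Gamma> \<cdot> A\<close>, \<open>q\<^sub>A\<close> and \<open>p\<^sub>A\<close> are preserved. The action of \<open>p\<^sup>*\<close> on arrows and the units are
  arrows induced by the pullback property, hence they are preserved automatically.\<close>

section \<open>Pointwise reasoning about functors and their composites\<close>

lemma func_comp_eqI:
  assumes "\<And>X. X \<in> Obj C \<Longrightarrow> omap G (omap F X) = omap G' (omap F' X)"
    and "\<And>f. f \<in> Arr C \<Longrightarrow> amap G (amap F f) = amap G' (amap F' f)"
  shows "func_comp C G F = func_comp C G' F'"
  using assms by (auto simp: func_comp_def intro!: restrict_ext)

lemma func_comp_eq_omapD:
  assumes "func_comp C G F = func_comp C G' F'" "X \<in> Obj C"
  shows "omap G (omap F X) = omap G' (omap F' X)"
proof -
  have "omap (func_comp C G F) X = omap (func_comp C G' F') X" using assms(1) by simp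
  with assms(2) show ?thesis by (simp add: func_comp_def)
qed

lemma func_comp_eq_amapD:
  assumes "func_comp C G F = func_comp C G' F'" "f \<in> Arr C"
  shows "amap G (amap F f) = amap G' (amap F' f)"
proof -
  have "amap (func_comp C G F) f = amap (func_comp C G' F') f" using assms(1) by simp
  with assms(2) show ?thesis by (simp add: func_comp_def)
qed

lemma functor_Obj: "is_functor C D F \<Longrightarrow> X \<in> Obj C \<Longrightarrow> omap F X \<in> Obj D"
  by (auto simp: is_functor_def)

lemma functor_hom: "is_functor C D F \<Longrightarrow> f \<in> hom C X Y \<Longrightarrow> amap F f \<in> hom D (omap F X) (omap F Y)"
  by (auto simp: is_functor_def hom_def)

lemma functor_Ident:
  "is_functor C D F \<Longrightarrow> X \<in> Obj C \<Longrightarrow> amap F (Ident C X) = Ident D (omap F X)"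
  by (simp add: is_functor_def)

lemma functor_Comp:
  "is_functor C D F \<Longrightarrow> f \<in> hom C X Y \<Longrightarrow> g \<in> hom C Y Z \<Longrightarrow>
   amap F (Comp C g f) = Comp D (amap F g) (amap F f)"
  by (simp add: is_functor_def)

text \<open>Agreement on the carriers suffices because all maps are \<open>undefined\<close>
  elsewhere. The type annotation fixes the record extension to \<open>unit\<close>, so the two
  fields determine the functor.\<close>

lemma func_eqI:
  fixes F G :: "('o, 'a, 'p, 'b) func"
  assumes "omap F \<in> extensional A" "omap G \<in> extensional A"
    and "amap F \<in> extensional B" "amap G \<in> extensional B"
    and "\<And>X. X \<in> A \<Longrightarrow> omap F X = omap G X" "\<And>f. f \<in> B \<Longrightarrow> amap F f = amap G f"
  shows "F = G"
  using extensionalityI[OF assms(1,2,5)] extensionalityI[OF assms(3,4,6)] by simp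


section \<open>Functors between categories of elements over a functor\<close>

text \<open>This is a presheaf map from \<open>P\<close> to \<open>Q\<close> precomposed with
  \<open>F\<close>. It is made extensional in both arguments so that the functor it induces
  determines it (\<open>el_func_inj\<close>), and so that it matches the clauses on
  \<open>mty\<close> and \<open>mtm\<close> in \<open>is_nm_morphism\<close>.\<close>

definition is_psh_map_over ::
  "('o, 'a) cat \<Rightarrow> ('o, 'a, 'p, 'b) func \<Rightarrow> ('o, 'a, 'x) psh \<Rightarrow> ('p, 'b, 'y) psh \<Rightarrow>
   ('o \<Rightarrow> 'x \<Rightarrow> 'y) \<Rightarrow> bool" where
  "is_psh_map_over C F P Q \<phi> \<longleftrightarrow>
     \<phi> \<in> (\<Pi>\<^sub>E \<Gamma> \<in> Obj C. Fib P \<Gamma> \<rightarrow>\<^sub>E Fib Q (omap F \<Gamma>)) \<and>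
     (\<forall>\<Delta> \<Gamma>. \<forall>\<sigma> \<in> hom C \<Delta> \<Gamma>. \<forall>x \<in> Fib P \<Gamma>. \<phi> \<Delta> (Res P \<sigma> x) = Res Q (amap F \<sigma>) (\<phi> \<Gamma> x))"

lemma psh_map_over_in:
  "is_psh_map_over C F P Q \<phi> \<Longrightarrow> \<Gamma> \<in> Obj C \<Longrightarrow> x \<in> Fib P \<Gamma> \<Longrightarrow> \<phi> \<Gamma> x \<in> Fib Q (omap F \<Gamma>)"
  by (auto simp: is_psh_map_over_def dest!: PiE_mem)

lemma psh_map_over_Res:
  "is_psh_map_over C F P Q \<phi> \<Longrightarrow> \<sigma> \<in> hom C \<Delta> \<Gamma> \<Longrightarrow> x \<in> Fib P \<Gamma> \<Longrightarrow>
   \<phi> \<Delta> (Res P \<sigma> x) = Res Q (amap F \<sigma>) (\<phi> \<Gamma> x)"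
  by (simp add: is_psh_map_over_def)

lemma omap_el_func:
  "\<Gamma> \<in> Obj C \<Longrightarrow> x \<in> Fib P \<Gamma> \<Longrightarrow> omap (el_func C P F \<phi>) (\<Gamma>, x) = (omap F \<Gamma>, \<phi> \<Gamma> x)"
  by (simp add: el_func_def Obj_el)

lemma amap_el_func:
  "((\<Delta>, y), \<sigma>, (\<Gamma>, x)) \<in> Arr (el C P) \<Longrightarrow>
   amap (el_func C P F \<phi>) ((\<Delta>, y), \<sigma>, (\<Gamma>, x)) =
     ((omap F \<Delta>, \<phi> \<Delta> y), amap F \<sigma>, (omap F \<Gamma>, \<phi> \<Gamma> x))"
  by (simp add: el_func_def)

text \<open>Naturality of \<phi> at \<sigma> is precisely the restriction equation that the image
  triple must satisfy.\<close>

lemma psh_map_over_Arr: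
  assumes "is_functor C D F" "is_psh_map_over C F P Q \<phi>" "((\<Delta>, y), \<sigma>, (\<Gamma>, x)) \<in> Arr (el C P)"
  shows "((omap F \<Delta>, \<phi> \<Delta> y), amap F \<sigma>, (omap F \<Gamma>, \<phi> \<Gamma> x)) \<in> Arr (el D Q)"
  using assms(3) functor_Obj[OF assms(1)] functor_hom[OF assms(1)] psh_map_over_in[OF assms(2)]
    psh_map_over_Res[OF assms(2)]
  by (auto simp: Arr_el)

lemma el_func_functor:
  assumes C: "category C" and P: "is_presheaf C P"
    and F: "is_functor C D F" and \<phi>: "is_psh_map_over C F P Q \<phi>"
  shows "is_functor (el C P) (el D Q) (el_func C P F \<phi>)"
proof -
  interpret E: category "el C P" using C P by (rule el_category)
  show ?thesis
  proof (rule is_functorI[OF E.category_axioms])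
    show "omap (el_func C P F \<phi>) \<in> Obj (el C P) \<rightarrow>\<^sub>E Obj (el D Q)"
      by (auto simp: el_func_def Obj_el functor_Obj[OF F] psh_map_over_in[OF \<phi>])
  next
    fix X assume X: "X \<in> Obj (el C P)"
    then have "Ident (el C P) X \<in> Arr (el C P)" using E.Ident_in by (simp add: hom_def)
    with X show "amap (el_func C P F \<phi>) (Ident (el C P) X) =
        Ident (el D Q) (omap (el_func C P F \<phi>) X)"
      by (cases X) (simp add: el_func_def el_sel Obj_el functor_Ident[OF F])
  next
    fix f g X Y Z assume fg: "f \<in> hom (el C P) X Y" "g \<in> hom (el C P) Y Z"
    then have "Comp (el C P) g f \<in> Arr (el C P)" using E.Comp_in by (simp add: hom_def)
    with fg show "amap (el_func C P F \<phi>) (Comp (el C P) g f) =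
        Comp (el D Q) (amap (el_func C P F \<phi>) g) (amap (el_func C P F \<phi>) f)"
      by (auto elim!: hom_elE simp: el_func_def el_sel Arr_el intro: functor_Comp[OF F])
  next
    fix f X Y assume "f \<in> hom (el C P) X Y" "X \<in> Obj (el C P)" "Y \<in> Obj (el C P)"
    then show "amap (el_func C P F \<phi>) f \<in>
        hom (el D Q) (omap (el_func C P F \<phi>) X) (omap (el_func C P F \<phi>) Y)"
      by (auto elim!: hom_elE simp: hom_el amap_el_func omap_el_func Obj_el
          psh_map_over_Arr[OF F \<phi>])
  qed (auto simp: el_func_def)
qed

lemma el_func_over:
  assumes F: "is_functor C D F" and \<phi>: "is_psh_map_over C F P Q \<phi>"
  shows "func_comp (el C P) (el_proj D Q) (el_func C P F \<phi>) = func_comp (el C P) F (el_proj C P)"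
proof (rule func_comp_eqI)
  fix X assume "X \<in> Obj (el C P)"
  then show "omap (el_proj D Q) (omap (el_func C P F \<phi>) X) = omap F (omap (el_proj C P) X)"
    by (cases X) (auto simp: el_proj_def omap_el_func Obj_el functor_Obj[OF F]
        psh_map_over_in[OF \<phi>])
next
  fix f assume f: "f \<in> Arr (el C P)"
  obtain \<Delta> y \<sigma> \<Gamma> x where fe: "f = ((\<Delta>, y), \<sigma>, (\<Gamma>, x))" by (metis prod.collapse)
  show "amap (el_proj D Q) (amap (el_func C P F \<phi>) f) = amap F (amap (el_proj C P) f)"
    \<comment> \<open>\<open>el_proj\<close> is specified only on arrows, so the image of
      \<open>f\<close> must first be known to be one.\<close>
    using f psh_map_over_Arr[OF F \<phi> f[unfolded fe]] by (simp add: fe amap_el_func el_proj_def)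
qed

text \<open>The value \<phi> \<Gamma> x is the second component of the induced functor at (\<Gamma>,
  x); off the carriers extensionality forces agreement.\<close>

lemma el_func_inj:
  assumes "is_psh_map_over C F P Q \<phi>" "is_psh_map_over C F P Q \<psi>"
    and "el_func C P F \<phi> = el_func C P F \<psi>"
  shows "\<phi> = \<psi>"
proof (rule ext)
  fix \<Gamma>
  show "\<phi> \<Gamma> = \<psi> \<Gamma>"
  proof (cases "\<Gamma> \<in> Obj C")
    case True
    with assms(1,2) have "\<phi> \<Gamma> \<in> extensional (Fib P \<Gamma>)" "\<psi> \<Gamma> \<in> extensional (Fib P \<Gamma>)"
      by (auto simp: is_psh_map_over_def PiE_def)
    then show ?thesis
    proof (rule extensionalityI)
      fix x assume "x \<in> Fib P \<Gamma>"
      with True assms(3) show "\<phi> \<Gamma> x = \<psi> \<Gamma> x"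
        by (metis omap_el_func prod.inject)
    qed
  next
    case False
    with assms(1,2) show ?thesis by (auto simp: is_psh_map_over_def PiE_def extensional_def)
  qed
qed

text \<open>Lying over \<open>F\<close> fixes the first components of objects and the underlying
  arrows of \<open>G\<close>. Only the second components of objects remain free, and they form
  \<phi>. Naturality of \<phi> then expresses that \<open>G\<close> sends arrows to arrows.\<close>

lemma functor_over_imp_el_func:
  assumes C: "category C" and P: "is_presheaf C P"
    and G: "is_functor (el C P) (el D Q) G"
    and over: "func_comp (el C P) (el_proj D Q) G = func_comp (el C P) F (el_proj C P)"
  obtains \<phi> where "is_psh_map_over C F P Q \<phi>" "G = el_func C P F \<phi>"
proof -
  interpret category C by fact
  define \<phi> where "\<phi> = (\<lambda>\<Gamma> \<in> Obj C. \<lambda>x \<in> Fib P \<Gamma>. snd (omap G (\<Gamma>, x)))"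
  have G_omap: "omap G (\<Gamma>, x) = (omap F \<Gamma>, \<phi> \<Gamma> x)" and \<phi>_in: "\<phi> \<Gamma> x \<in> Fib Q (omap F \<Gamma>)"
    if "\<Gamma> \<in> Obj C" "x \<in> Fib P \<Gamma>" for \<Gamma> x
  proof -
    have X: "(\<Gamma>, x) \<in> Obj (el C P)" using that by (simp add: Obj_el)
    note GX = functor_Obj[OF G X]
    have "fst (omap G (\<Gamma>, x)) = omap F \<Gamma>"
      using func_comp_eq_omapD[OF over X] GX X by (cases "omap G (\<Gamma>, x)") (simp add: el_proj_def)
    then show 1: "omap G (\<Gamma>, x) = (omap F \<Gamma>, \<phi> \<Gamma> x)"
      using that by (simp add: \<phi>_def prod_eq_iff)
    then show "\<phi> \<Gamma> x \<in> Fib Q (omap F \<Gamma>)" using GX by (simp add: Obj_el)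
  qed
  have G_amap: "amap G ((\<Delta>, y), \<sigma>, (\<Gamma>, x)) =
      ((omap F \<Delta>, \<phi> \<Delta> y), amap F \<sigma>, (omap F \<Gamma>, \<phi> \<Gamma> x))"
    and G_arr: "((omap F \<Delta>, \<phi> \<Delta> y), amap F \<sigma>, (omap F \<Gamma>, \<phi> \<Gamma> x)) \<in> Arr (el D Q)"
    if f: "((\<Delta>, y), \<sigma>, (\<Gamma>, x)) \<in> Arr (el C P)" for \<Delta> y \<sigma> \<Gamma> x
  proof -
    have "((\<Delta>, y), \<sigma>, (\<Gamma>, x)) \<in> hom (el C P) (\<Delta>, y) (\<Gamma>, x)" using f by (simp add: hom_el)
    from functor_hom[OF G this]
    have h: "amap G ((\<Delta>, y), \<sigma>, (\<Gamma>, x)) \<in>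
        hom (el D Q) (omap F \<Delta>, \<phi> \<Delta> y) (omap F \<Gamma>, \<phi> \<Gamma> x)"
      using f by (simp add: Arr_el G_omap)
    then obtain \<tau> where t: "amap G ((\<Delta>, y), \<sigma>, (\<Gamma>, x)) =
        ((omap F \<Delta>, \<phi> \<Delta> y), \<tau>, (omap F \<Gamma>, \<phi> \<Gamma> x))"
        "((omap F \<Delta>, \<phi> \<Delta> y), \<tau>, (omap F \<Gamma>, \<phi> \<Gamma> x)) \<in> Arr (el D Q)"
      by (auto elim!: hom_elE)
    \<comment> \<open>Functoriality determined only the endpoints; the equation of projections
      identifies the underlying arrow.\<close>
    with func_comp_eq_amapD[OF over f] f have "\<tau> = amap F \<sigma>" by (simp add: el_proj_def)
    with t show "amap G ((\<Delta>, y), \<sigma>, (\<Gamma>, x)) =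
      ((omap F \<Delta>, \<phi> \<Delta> y), amap F \<sigma>, (omap F \<Gamma>, \<phi> \<Gamma> x))"
      "((omap F \<Delta>, \<phi> \<Delta> y), amap F \<sigma>, (omap F \<Gamma>, \<phi> \<Gamma> x)) \<in> Arr (el D Q)" by simp_all
  qed
  have "is_psh_map_over C F P Q \<phi>"
    unfolding is_psh_map_over_def
  proof (intro conjI allI ballI)
    show "\<phi> \<in> (\<Pi>\<^sub>E \<Gamma> \<in> Obj C. Fib P \<Gamma> \<rightarrow>\<^sub>E Fib Q (omap F \<Gamma>))"
      using \<phi>_in by (auto simp: \<phi>_def)
  next
    fix \<Delta> \<Gamma> \<sigma> x assume \<sigma>: "\<sigma> \<in> hom C \<Delta> \<Gamma>" and x: "x \<in> Fib P \<Gamma>"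
    \<comment> \<open>Every \<sigma> and x give an arrow of elements with source x[\<sigma>]; the
      restriction equation of its image is naturality.\<close>
    then have "((\<Delta>, Res P \<sigma> x), \<sigma>, (\<Gamma>, x)) \<in> Arr (el C P)"
      using presheaf_Res_in[OF P \<sigma> x] Dom_in Cod_in by (auto simp: Arr_el hom_def)
    from G_arr[OF this] show "\<phi> \<Delta> (Res P \<sigma> x) = Res Q (amap F \<sigma>) (\<phi> \<Gamma> x)" by (simp add: Arr_el)
  qed
  moreover have "G = el_func C P F \<phi>"
  proof (rule func_eqI)
    show "omap G \<in> extensional (Obj (el C P))" "amap G \<in> extensional (Arr (el C P))"
      using G by (auto simp: is_functor_def PiE_def)
    show "omap (el_func C P F \<phi>) \<in> extensional (Obj (el C P))"
      "amap (el_func C P F \<phi>) \<in> extensional (Arr (el C P))" by (simp_all add: el_func_def)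
    show "omap G X = omap (el_func C P F \<phi>) X" if "X \<in> Obj (el C P)" for X
      using that by (cases X) (simp add: Obj_el omap_el_func G_omap)
    show "amap G f = amap (el_func C P F \<phi>) f" if f: "f \<in> Arr (el C P)" for f
    proof -
      obtain \<Delta> y \<sigma> \<Gamma> x where "f = ((\<Delta>, y), \<sigma>, (\<Gamma>, x))" by (metis prod.collapse)
      with f show ?thesis by (simp add: amap_el_func G_amap)
    qed
  qed
  ultimately show thesis by (rule that)
qed


section \<open>Preservation of typing and of context extension\<close>

text \<open>Splitting the joint naturality clause and grouping its halves with the typing of
  \<open>mty\<close> and \<open>mtm\<close> makes the correspondence with functors over
  \<open>mbase F\<close> applicable to each family.\<close>

lemma nm_morphism_iff:
  "is_nm_morphism M N F \<longleftrightarrow>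
     is_functor (Base M) (Base N) (mbase F) \<and>
     omap (mbase F) (Term M) = Term N \<and>
     is_psh_map_over (Base M) (mbase F) (Ty M) (Ty N) (mty F) \<and>
     is_psh_map_over (Base M) (mbase F) (Tm M) (Tm N) (mtm F) \<and>
     (\<forall>\<Gamma> \<in> Obj (Base M). \<forall>a \<in> Fib (Tm M) \<Gamma>.
        typeof N (omap (mbase F) \<Gamma>) (mtm F \<Gamma> a) = mty F \<Gamma> (typeof M \<Gamma> a)) \<and>
     (\<forall>\<Gamma> \<in> Obj (Base M). \<forall>A \<in> Fib (Ty M) \<Gamma>.
        omap (mbase F) (ext M \<Gamma> A) = ext N (omap (mbase F) \<Gamma>) (mty F \<Gamma> A) \<and>
        amap (mbase F) (wk M \<Gamma> A) = wk N (omap (mbase F) \<Gamma>) (mty F \<Gamma> A) \<and>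
        mtm F (ext M \<Gamma> A) (vr M \<Gamma> A) = vr N (omap (mbase F) \<Gamma>) (mty F \<Gamma> A))"
  unfolding is_nm_morphism_def is_psh_map_over_def by blast

context natural_model
begin

text \<open>Functors between categories of elements are specified only on arrows. This fact,
  \<open>unit_Arr\<close> and \<open>radj_Arr\<close> allow them to be evaluated at the counit, at
  the unit and at images under \<open>radj\<close>.\<close>

lemma counit_Arr:
  assumes "\<Gamma> \<in> Ctx" "A \<in> Tyf \<Gamma>"
  shows "((ext M \<Gamma> A, typeof M (ext M \<Gamma> A) (vr M \<Gamma> A)), wk M \<Gamma> A, (\<Gamma>, A)) \<in> Arr (elTy M)"
  using assms typeof_in[OF ext_in[OF assms] vr_in[OF assms]]
  by (simp add: Arr_el ext_in wk_in typeof_vr)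

lemma unit_Arr:
  assumes "\<Gamma> \<in> Ctx" "a \<in> Tmf \<Gamma>"
  shows "((\<Gamma>, a), lift M \<Gamma> (Ident (Base M) \<Gamma>) a \<Gamma> (typeof M \<Gamma> a),
    (ext M \<Gamma> (typeof M \<Gamma> a), vr M \<Gamma> (typeof M \<Gamma> a))) \<in> Arr (elTm M)"
  using assms unit_lifts[OF assms] by (simp add: Arr_el ext_in vr_in typeof_in)

lemma radj_Arr:
  assumes "((\<Delta>, B), \<sigma>, (\<Gamma>, A)) \<in> Arr (elTy M)"
  shows "((ext M \<Delta> B, vr M \<Delta> B),
    lift M (ext M \<Delta> B) (Comp (Base M) \<sigma> (wk M \<Delta> B)) (vr M \<Delta> B) \<Gamma> A,
    (ext M \<Gamma> A, vr M \<Gamma> A)) \<in> Arr (elTm M)"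
  using assms el_arrow_lifts[OF assms] by (simp add: Arr_el ext_in vr_in)

end

text \<open>The data common to both sides of the correspondence: a functor and two families natural
  over it. Compatibility with typing and context extension is left out, since it is what
  \<open>nm_morphism_iff_comm\<close> compares.\<close>

locale model_map = M: natural_model M + N: natural_model N
  for M :: "('o, 'a, 'u, 'e) nmod" and N :: "('p, 'b, 'v, 'f) nmod" +
  fixes F :: "('o, 'a, 'p, 'b) func" and \<phi> :: "'o \<Rightarrow> 'u \<Rightarrow> 'v" and \<psi> :: "'o \<Rightarrow> 'e \<Rightarrow> 'f"
  assumes F: "is_functor (Base M) (Base N) F"
    and \<phi>: "is_psh_map_over (Base M) F (Ty M) (Ty N) \<phi>"
    and \<psi>: "is_psh_map_over (Base M) F (Tm M) (Tm N) \<psi>"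
begin

abbreviation "F\<^sub>1 \<equiv> el_func (Base M) (Ty M) F \<phi>"
abbreviation "F\<^sub>2 \<equiv> el_func (Base M) (Tm M) F \<psi>"

lemmas F_Obj = functor_Obj[OF F]
lemmas \<phi>_in = psh_map_over_in[OF \<phi>]
lemmas \<psi>_in = psh_map_over_in[OF \<psi>]

text \<open>Both composites send an arrow over \<sigma> to one over F \<sigma>, so on arrows they
  can differ only in the endpoints, where the equation on objects decides.\<close>

lemma typeof_comm_iff:
  "func_comp (elTm M) (el_typeof N) F\<^sub>2 = func_comp (elTm M) F\<^sub>1 (el_typeof M) \<longleftrightarrow>
   (\<forall>\<Gamma> \<in> M.Ctx. \<forall>a \<in> M.Tmf \<Gamma>. typeof N (omap F \<Gamma>) (\<psi> \<Gamma> a) = \<phi> \<Gamma> (typeof M \<Gamma> a))"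
  (is "?L \<longleftrightarrow> ?R")
proof
  assume L: ?L
  show ?R
  proof (intro ballI)
    fix \<Gamma> a assume "\<Gamma> \<in> M.Ctx" "a \<in> M.Tmf \<Gamma>"
    with func_comp_eq_omapD[OF L, of "(\<Gamma>, a)"]
    show "typeof N (omap F \<Gamma>) (\<psi> \<Gamma> a) = \<phi> \<Gamma> (typeof M \<Gamma> a)"
      by (simp add: Obj_el omap_el_func el_map_def M.typeof_in F_Obj \<psi>_in)
  qed
next
  assume R: ?R
  show ?L
  proof (rule func_comp_eqI)
    fix X assume "X \<in> Obj (elTm M)"
    with R show "omap (el_typeof N) (omap F\<^sub>2 X) = omap F\<^sub>1 (omap (el_typeof M) X)"
      by (cases X) (simp add: Obj_el omap_el_func el_map_def M.typeof_in F_Obj \<psi>_in)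
  next
    fix f assume f: "f \<in> Arr (elTm M)"
    obtain \<Delta> b \<sigma> \<Gamma> a where fe: "f = ((\<Delta>, b), \<sigma>, (\<Gamma>, a))" by (metis prod.collapse)
    have A: "\<Delta> \<in> M.Ctx" "b \<in> M.Tmf \<Delta>" "\<Gamma> \<in> M.Ctx" "a \<in> M.Tmf \<Gamma>"
      "\<sigma> \<in> hom (Base M) \<Delta> \<Gamma>" "Res (Tm M) \<sigma> a = b" using f by (auto simp: fe Arr_el)
    then have "((\<Delta>, typeof M \<Delta> b), \<sigma>, (\<Gamma>, typeof M \<Gamma> a)) \<in> Arr (elTy M)"
      using M.typeof_Res by (auto simp: Arr_el M.typeof_in)
    with f R A psh_map_over_Arr[OF F \<psi> f[unfolded fe]]
    show "amap (el_typeof N) (amap F\<^sub>2 f) = amap F\<^sub>1 (amap (el_typeof M) f)"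
      by (simp add: fe amap_el_func el_map_def)
  qed
qed

text \<open>At the object (\<Gamma>, A) both composites are pairs; the two conclusions are the
  equalities of their components.\<close>

lemma radj_comm_imp:
  assumes "func_comp (elTy M) F\<^sub>2 (radj M) = func_comp (elTy M) (radj N) F\<^sub>1"
    and "\<Gamma> \<in> M.Ctx" "A \<in> M.Tyf \<Gamma>"
  shows "omap F (ext M \<Gamma> A) = ext N (omap F \<Gamma>) (\<phi> \<Gamma> A)"
    and "\<psi> (ext M \<Gamma> A) (vr M \<Gamma> A) = vr N (omap F \<Gamma>) (\<phi> \<Gamma> A)"
  using func_comp_eq_omapD[OF assms(1), of "(\<Gamma>, A)"] assms(2,3)
  by (simp_all add: Obj_el omap_el_func radj_def M.ext_in M.vr_in F_Obj \<phi>_in)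

text \<open>The underlying arrows of the two whiskerings are compared at (\<Gamma>, A).\<close>

lemma counit_comm_imp:
  assumes "whisker_left (elTy M) F\<^sub>1 (adj_counit M) = whisker_right (elTy M) (adj_counit N) F\<^sub>1"
    and "\<Gamma> \<in> M.Ctx" "A \<in> M.Tyf \<Gamma>"
  shows "amap F (wk M \<Gamma> A) = wk N (omap F \<Gamma>) (\<phi> \<Gamma> A)"
  using fun_cong[OF assms(1), of "(\<Gamma>, A)"] assms(2,3) M.counit_Arr[OF assms(2,3)]
  by (simp add: whisker_left_def whisker_right_def adj_counit_def Obj_el omap_el_func amap_el_func
      F_Obj \<phi>_in)

context
  assumes typeof_eq: "\<And>\<Gamma> a. \<Gamma> \<in> M.Ctx \<Longrightarrow> a \<in> M.Tmf \<Gamma> \<Longrightarrow>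
      typeof N (omap F \<Gamma>) (\<psi> \<Gamma> a) = \<phi> \<Gamma> (typeof M \<Gamma> a)"
    and ext_eq: "\<And>\<Gamma> A. \<Gamma> \<in> M.Ctx \<Longrightarrow> A \<in> M.Tyf \<Gamma> \<Longrightarrow>
      omap F (ext M \<Gamma> A) = ext N (omap F \<Gamma>) (\<phi> \<Gamma> A)"
    and wk_eq: "\<And>\<Gamma> A. \<Gamma> \<in> M.Ctx \<Longrightarrow> A \<in> M.Tyf \<Gamma> \<Longrightarrow>
      amap F (wk M \<Gamma> A) = wk N (omap F \<Gamma>) (\<phi> \<Gamma> A)"
    and vr_eq: "\<And>\<Gamma> A. \<Gamma> \<in> M.Ctx \<Longrightarrow> A \<in> M.Tyf \<Gamma> \<Longrightarrow>
      \<psi> (ext M \<Gamma> A) (vr M \<Gamma> A) = vr N (omap F \<Gamma>) (\<phi> \<Gamma> A)"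
begin

text \<open>An arrow into a context extension is determined by its composite with \<open>wk\<close>
  and by the restriction of \<open>vr\<close> along it. Since \<open>ext\<close>, \<open>wk\<close>
  and \<open>vr\<close> are preserved, applying \<open>F\<close> and \<psi> turns the equations
  characterising the lift in \<open>M\<close> into those characterising the lift in
  \<open>N\<close>.\<close>

lemma amap_lift:
  assumes \<Gamma>: "\<Gamma> \<in> M.Ctx" and A: "A \<in> M.Tyf \<Gamma>" and \<Delta>: "\<Delta> \<in> M.Ctx"
    and \<sigma>: "\<sigma> \<in> hom (Base M) \<Delta> \<Gamma>" and a: "a \<in> M.Tmf \<Delta>"
    and type: "typeof M \<Delta> a = Res (Ty M) \<sigma> A"
  shows "amap F (lift M \<Delta> \<sigma> a \<Gamma> A) = lift N (omap F \<Delta>) (amap F \<sigma>) (\<psi> \<Delta> a) (omap F \<Gamma>) (\<phi> \<Gamma> A)"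
proof -
  note l = M.lift_lifts[OF \<Gamma> A \<Delta> \<sigma> a type]
  note w = M.wk_in[OF \<Gamma> A] and v = M.vr_in[OF \<Gamma> A]
  \<comment> \<open>Preservation of typing enters here: it makes the pair (F \<sigma>, \<psi>
    \<Delta> a) compatible, so that the lift in \<open>N\<close> exists.\<close>
  have "typeof N (omap F \<Delta>) (\<psi> \<Delta> a) = Res (Ty N) (amap F \<sigma>) (\<phi> \<Gamma> A)"
    using typeof_eq[OF \<Delta> a] type psh_map_over_Res[OF \<phi> \<sigma> A] by simp
  note l' = N.lift_lifts[OF F_Obj[OF \<Gamma>] \<phi>_in[OF \<Gamma> A] F_Obj[OF \<Delta>] functor_hom[OF F \<sigma>]
      \<psi>_in[OF \<Delta> a] this]
  show ?thesis
  proof (rule N.arrow_into_ext_eqI[OF F_Obj[OF \<Gamma>] \<phi>_in[OF \<Gamma> A]])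
    show "amap F (lift M \<Delta> \<sigma> a \<Gamma> A) \<in> hom (Base N) (omap F \<Delta>) (ext N (omap F \<Gamma>) (\<phi> \<Gamma> A))"
      using functor_hom[OF F conjunct1[OF l]] ext_eq[OF \<Gamma> A] by simp
    show "lift N (omap F \<Delta>) (amap F \<sigma>) (\<psi> \<Delta> a) (omap F \<Gamma>) (\<phi> \<Gamma> A) \<in>
        hom (Base N) (omap F \<Delta>) (ext N (omap F \<Gamma>) (\<phi> \<Gamma> A))"
      using l' by blast
    show "Comp (Base N) (wk N (omap F \<Gamma>) (\<phi> \<Gamma> A)) (amap F (lift M \<Delta> \<sigma> a \<Gamma> A)) =
        Comp (Base N) (wk N (omap F \<Gamma>) (\<phi> \<Gamma> A))
          (lift N (omap F \<Delta>) (amap F \<sigma>) (\<psi> \<Delta> a) (omap F \<Gamma>) (\<phi> \<Gamma> A))"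
      using functor_Comp[OF F conjunct1[OF l] w] l l' wk_eq[OF \<Gamma> A] by simp
    show "Res (Tm N) (amap F (lift M \<Delta> \<sigma> a \<Gamma> A)) (vr N (omap F \<Gamma>) (\<phi> \<Gamma> A)) =
        Res (Tm N) (lift N (omap F \<Delta>) (amap F \<sigma>) (\<psi> \<Delta> a) (omap F \<Gamma>) (\<phi> \<Gamma> A))
          (vr N (omap F \<Gamma>) (\<phi> \<Gamma> A))"
      using psh_map_over_Res[OF \<psi> conjunct1[OF l] v] l l' vr_eq[OF \<Gamma> A] by simp
  qed
qed

text \<open>On objects this is \<open>ext_eq\<close> and \<open>vr_eq\<close>. On arrows the right
  adjoint is itself a \<open>lift\<close>, of \<sigma> composed with \<open>wk\<close>, so
  \<open>amap_lift\<close> transports it; \<open>functor_Comp\<close> and \<open>wk_eq\<close>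
  identify the image of that composite.\<close>

lemma radj_comm: "func_comp (elTy M) F\<^sub>2 (radj M) = func_comp (elTy M) (radj N) F\<^sub>1"
proof (rule func_comp_eqI)
  fix X assume "X \<in> Obj (elTy M)"
  then show "omap F\<^sub>2 (omap (radj M) X) = omap (radj N) (omap F\<^sub>1 X)"
    by (cases X) (simp add: Obj_el omap_el_func radj_def M.ext_in M.vr_in F_Obj \<phi>_in ext_eq vr_eq)
next
  fix f assume f: "f \<in> Arr (elTy M)"
  obtain \<Delta> B \<sigma> \<Gamma> A where fe: "f = ((\<Delta>, B), \<sigma>, (\<Gamma>, A))" by (metis prod.collapse)
  have A: "\<Delta> \<in> M.Ctx" "B \<in> M.Tyf \<Delta>" "\<Gamma> \<in> M.Ctx" "A \<in> M.Tyf \<Gamma>"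
    "\<sigma> \<in> hom (Base M) \<Delta> \<Gamma>" "Res (Ty M) \<sigma> A = B" using f by (auto simp: fe Arr_el)
  note w = M.wk_in[OF A(1,2)]
  have "typeof M (ext M \<Delta> B) (vr M \<Delta> B) = Res (Ty M) (Comp (Base M) \<sigma> (wk M \<Delta> B)) A"
    using presheaf_Comp[OF M.ty w A(5,4)] M.typeof_vr[OF A(1,2)] A(6) by simp
  from amap_lift[OF A(3,4) M.ext_in[OF A(1,2)] M.B.Comp_in[OF w A(5)] M.vr_in[OF A(1,2)] this]
  show "amap F\<^sub>2 (amap (radj M) f) = amap (radj N) (amap F\<^sub>1 f)"
    using f A M.radj_Arr[OF f[unfolded fe]] psh_map_over_Arr[OF F \<phi> f[unfolded fe]]
      functor_Comp[OF F w A(5)]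
    by (simp add: fe radj_def amap_el_func ext_eq vr_eq wk_eq)
qed

lemma counit_comm:
  "whisker_left (elTy M) F\<^sub>1 (adj_counit M) = whisker_right (elTy M) (adj_counit N) F\<^sub>1"
  unfolding whisker_left_def whisker_right_def
proof (rule restrict_ext)
  fix X assume "X \<in> Obj (elTy M)"
  then obtain \<Gamma> A where X: "X = (\<Gamma>, A)" "\<Gamma> \<in> M.Ctx" "A \<in> M.Tyf \<Gamma>"
    by (cases X) (auto simp: Obj_el)
  show "amap F\<^sub>1 (adj_counit M X) = adj_counit N (omap F\<^sub>1 X)"
    \<comment> \<open>The source of the counit carries the type of \<open>vr\<close>, so
      \<open>typeof_eq\<close> is needed at the extended context to match the endpoints.\<close>
    using X M.counit_Arr[OF X(2,3)] typeof_eq[OF M.ext_in[OF X(2,3)] M.vr_in[OF X(2,3)]]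
    by (simp add: adj_counit_def Obj_el omap_el_func amap_el_func F_Obj \<phi>_in ext_eq wk_eq vr_eq)
qed

text \<open>The unit is the lift of an identity, so \<open>amap_lift\<close> applies;
  \<open>typeof_eq\<close> matches the type over which the two lifts are formed.\<close>

lemma unit_comm:
  "whisker_left (elTm M) F\<^sub>2 (adj_unit M) = whisker_right (elTm M) (adj_unit N) F\<^sub>2"
  unfolding whisker_left_def whisker_right_def
proof (rule restrict_ext)
  fix X assume "X \<in> Obj (elTm M)"
  then obtain \<Gamma> a where X: "X = (\<Gamma>, a)" "\<Gamma> \<in> M.Ctx" "a \<in> M.Tmf \<Gamma>"
    by (cases X) (auto simp: Obj_el)
  note T = M.typeof_in[OF X(2,3)]
  have "typeof M \<Gamma> a = Res (Ty M) (Ident (Base M) \<Gamma>) (typeof M \<Gamma> a)"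
    by (simp add: presheaf_Ident[OF M.ty X(2) T])
  from amap_lift[OF X(2) T X(2) M.B.Ident_in[OF X(2)] X(3) this]
  show "amap F\<^sub>2 (adj_unit M X) = adj_unit N (omap F\<^sub>2 X)"
    using X T M.unit_Arr[OF X(2,3)]
    by (simp add: adj_unit_def Let_def Obj_el omap_el_func amap_el_func F_Obj \<psi>_in ext_eq vr_eq
        typeof_eq functor_Ident[OF F])
qed

end

text \<open>From left to right, the preservation clauses supply the hypotheses of
  \<open>amap_lift\<close> and its consequences. From right to left, \<open>ext\<close> and
  \<open>vr\<close> are read off from \<open>radj\<close> on objects, \<open>wk\<close> from the
  counit, and typing from \<open>typeof_comm_iff\<close>.\<close>

lemma nm_morphism_iff_comm:
  "is_nm_morphism M N \<lparr> mbase = F, mty = \<phi>, mtm = \<psi> \<rparr> \<longleftrightarrow>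
     omap F (Term M) = Term N \<and>
     func_comp (elTm M) (el_typeof N) F\<^sub>2 = func_comp (elTm M) F\<^sub>1 (el_typeof M) \<and>
     func_comp (elTy M) F\<^sub>2 (radj M) = func_comp (elTy M) (radj N) F\<^sub>1 \<and>
     whisker_left (elTy M) F\<^sub>1 (adj_counit M) = whisker_right (elTy M) (adj_counit N) F\<^sub>1 \<and>
     whisker_left (elTm M) F\<^sub>2 (adj_unit M) = whisker_right (elTm M) (adj_unit N) F\<^sub>2"
  (is "?L \<longleftrightarrow> ?R")
proof
  assume L: ?L
  then have typeof: "\<And>\<Gamma> a. \<Gamma> \<in> M.Ctx \<Longrightarrow> a \<in> M.Tmf \<Gamma> \<Longrightarrow>
        typeof N (omap F \<Gamma>) (\<psi> \<Gamma> a) = \<phi> \<Gamma> (typeof M \<Gamma> a)"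
    and ext: "\<And>\<Gamma> A. \<Gamma> \<in> M.Ctx \<Longrightarrow> A \<in> M.Tyf \<Gamma> \<Longrightarrow> omap F (ext M \<Gamma> A) = ext N (omap F \<Gamma>) (\<phi> \<Gamma> A)"
    and wk: "\<And>\<Gamma> A. \<Gamma> \<in> M.Ctx \<Longrightarrow> A \<in> M.Tyf \<Gamma> \<Longrightarrow> amap F (wk M \<Gamma> A) = wk N (omap F \<Gamma>) (\<phi> \<Gamma> A)"
    and vr: "\<And>\<Gamma> A. \<Gamma> \<in> M.Ctx \<Longrightarrow> A \<in> M.Tyf \<Gamma> \<Longrightarrow>
        \<psi> (ext M \<Gamma> A) (vr M \<Gamma> A) = vr N (omap F \<Gamma>) (\<phi> \<Gamma> A)"
    unfolding nm_morphism_iff by simp_all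
  note eqs = typeof ext wk vr
  show ?R
    using L typeof radj_comm[OF eqs] counit_comm[OF eqs] unit_comm[OF eqs]
    by (simp add: nm_morphism_iff typeof_comm_iff)
next
  assume ?R
  then show ?L
    using F \<phi> \<psi> radj_comm_imp counit_comm_imp by (simp add: nm_morphism_iff typeof_comm_iff)
qed

end

section \<open>The bijection between morphisms and triples of functors\<close>

theorem theorem2p3p2:
  fixes M :: "('o, 'a, 'u, 'e) nmod" and N :: "('p, 'b, 'v, 'f) nmod"
  assumes "natural_model M" and "natural_model N"
  shows "bij_betw
    (\<lambda>F. (mbase F,
          el_func (Base M) (Ty M) (mbase F) (mty F),
          el_func (Base M) (Tm M) (mbase F) (mtm F)))
    {F. is_nm_morphism M N F}
    {(F0, F1, F2).
       is_functor (Base M) (Base N) F0 \<and> omap F0 (Term M) = Term N \<and>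
       is_functor (elTy M) (elTy N) F1 \<and>
       is_functor (elTm M) (elTm N) F2 \<and>
       func_comp (elTy M) (projTy N) F1 = func_comp (elTy M) F0 (projTy M) \<and>
       func_comp (elTm M) (projTm N) F2 = func_comp (elTm M) F0 (projTm M) \<and>
       func_comp (elTm M) (el_typeof N) F2 = func_comp (elTm M) F1 (el_typeof M) \<and>
       func_comp (elTy M) F2 (radj M) = func_comp (elTy M) (radj N) F1 \<and>
       whisker_left (elTy M) F1 (adj_counit M) = whisker_right (elTy M) (adj_counit N) F1 \<and>
       whisker_left (elTm M) F2 (adj_unit M) = whisker_right (elTm M) (adj_unit N) F2}"
  (is "bij_betw ?\<Phi> ?A ?B")
proof -
  interpret M: natural_model M by fact
  interpret N: natural_model N by fact
  have map: "model_map M N (mbase F) (mty F) (mtm F)" if "is_nm_morphism M N F" for F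
    using that unfolding nm_morphism_iff by unfold_locales auto
  have "inj_on ?\<Phi> ?A"
  proof (rule inj_onI)
    fix F G :: "('o, 'a, 'u, 'e, 'p, 'b, 'v, 'f) nmor"
    assume "F \<in> ?A" "G \<in> ?A" and eq: "?\<Phi> F = ?\<Phi> G"
    \<comment> \<open>The first component of \<open>eq\<close> identifies the base functors, so the
      families of \<open>G\<close> also lie over \<open>mbase F\<close> and
      \<open>el_func_inj\<close> can compare them with those of \<open>F\<close>.\<close>
    then have F: "model_map M N (mbase F) (mty F) (mtm F)"
      and G: "model_map M N (mbase F) (mty G) (mtm G)" using map by force+
    have "mty F = mty G"
      by (rule el_func_inj[OF model_map.\<phi>[OF F] model_map.\<phi>[OF G]]) (use eq in auto)
    moreover have "mtm F = mtm G"
      by (rule el_func_inj[OF model_map.\<psi>[OF F] model_map.\<psi>[OF G]]) (use eq in auto)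
    ultimately show "F = G" using eq by simp
  qed
  moreover have "?\<Phi> F \<in> ?B" if "F \<in> ?A" for F
  proof -
    \<comment> \<open>Expanding the record gives the form in which
      \<open>nm_morphism_iff_comm\<close> is stated.\<close>
    have F: "is_nm_morphism M N \<lparr> mbase = mbase F, mty = mty F, mtm = mtm F \<rparr>"
      using that by (cases F) simp
    interpret F: model_map M N "mbase F" "mty F" "mtm F" using that by (intro map) simp
    show ?thesis
      using F[unfolded F.nm_morphism_iff_comm] F.F
        el_func_functor[OF M.base M.ty F.F F.\<phi>] el_func_functor[OF M.base M.tm F.F F.\<psi>]
        el_func_over[OF F.F F.\<phi>] el_func_over[OF F.F F.\<psi>]
      by simp
  qed
  moreover have "t \<in> ?\<Phi> ` ?A" if t: "t \<in> ?B" for t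
  proof -
    obtain F0 F1 F2 where te: "t = (F0, F1, F2)" by (cases t)
    have F0: "is_functor (Base M) (Base N) F0"
      and F1: "is_functor (elTy M) (elTy N) F1"
        "func_comp (elTy M) (projTy N) F1 = func_comp (elTy M) F0 (projTy M)"
      and F2: "is_functor (elTm M) (elTm N) F2"
        "func_comp (elTm M) (projTm N) F2 = func_comp (elTm M) F0 (projTm M)"
      using t by (simp_all add: te)
    \<comment> \<open>The preimage has base \<open>F0\<close>, and the projection equations yield
      its two families. Once \<open>F1\<close> and \<open>F2\<close> are rewritten as
      \<open>el_func\<close>, the other conditions on \<open>t\<close> become the right-hand side of
      \<open>nm_morphism_iff_comm\<close>.\<close>
    obtain \<phi> where \<phi>: "is_psh_map_over (Base M) F0 (Ty M) (Ty N) \<phi>"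
        "F1 = el_func (Base M) (Ty M) F0 \<phi>"
      using functor_over_imp_el_func[OF M.base M.ty F1] .
    obtain \<psi> where \<psi>: "is_psh_map_over (Base M) F0 (Tm M) (Tm N) \<psi>"
        "F2 = el_func (Base M) (Tm M) F0 \<psi>"
      using functor_over_imp_el_func[OF M.base M.tm F2] .
    interpret F: model_map M N F0 \<phi> \<psi> using F0 \<phi>(1) \<psi>(1) by unfold_locales
    have "is_nm_morphism M N \<lparr> mbase = F0, mty = \<phi>, mtm = \<psi> \<rparr>"
      unfolding F.nm_morphism_iff_comm using t by (simp add: te \<phi>(2) \<psi>(2))
    then show ?thesis by (intro rev_image_eqI[where x = "\<lparr> mbase = F0, mty = \<phi>, mtm = \<psi> \<rparr>"])
        (simp_all add: te \<phi>(2) \<psi>(2))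
  qed
  ultimately show ?thesis unfolding bij_betw_def by blast
qed

end
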